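(* Let $X$ be a complex Banach space, $n\ge 1$, $\alpha>0$, and let $T=(T_1,\dots,T_n)\in\mathcal{B}_n(X)$ and $S=(S_1,\dots,S_n)\in\mathcal{B}_n(X)$ be mutually commuting with each other. If $T\in\mathcal{G}_{n\alpha}(X)$, $a(T)<+\infty$ and $S\in\mathcal{P}(\mathcal{G}_{n\alpha}(X))$, then $a(T+S)<+\infty$.
   Context: $\mathcal{B}(X)$ is the algebra of bounded linear operators on $X$; $N(\cdot)$ and $R(\cdot)$ denote null space and range of an operator; $X^*$ is the dual space; $\mathbb{N}=\{0,1,2,\dots\}$. $\mathcal{B}_n(X)$ is the set of $n$-tuples $T=(T_1,\dots,T_n)$ of operators in $\mathcal{B}(X)$ with $T_iT_j=T_jT_i$ for all $i,j$. Two $n$-tuples $T,S$ are mutually commuting (with each other) if $T_iS_j=S_jT_i$ for all $i,j$. Sums $T+S$ are componentwise, $T^*=(T_1^*,\dots,T_n^* )$ is the tuple of dual operators on $X^*$. For $k\in\mathbb{N}$: $T^k=(T_1^k,\dots,T_n^k)$, $N(T^k)=\bigcap_{i=1}^n N(T_i^k)$, $R(T^k)=\sum_{i=1}^n R(T_i^k)$ (likewise for tuples on $X^*$). $R^\infty(T)=\bigcap_{k\ge 0}R(T^k)$, $N^\infty(T)=\bigcup_{k\ge 0}N(T^k)$. The ascent is $a(T)=\min\{k\in\mathbb{N}: N(T^k)=N(T^{k+1})\}$, and $a(T)=\infty$ if no such $k$ exists. For an $n$-tuple $A$, $\delta_A:X\to X^n$ is $\delta_A(x)=(A_1x,\dots,A_nx)$.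 $\|S\|=\sum_{i=1}^n\|S_i\|$ and $B(O,\varepsilon)$ is the open ball of radius $\varepsilon$ around the zero tuple. $\Phi_+^n(X)$ is the set of $T\in\mathcal{B}_n(X)$ with $\dim N(T)<\infty$ and $R(\delta_T)$ closed. $T\in\mathcal{B}_n(X)$ is essentially Kato if $R(T)$ is closed and there is a finite-dimensional subspace $F\subset N^\infty(T)$ with $N^\infty(T)\subset R^\infty(T)+F$. $\mathcal{C}_n(X)$ is the set of $T\in\mathcal{B}_n(X)$ such that: (i) $T\in\Phi_+^n(X)$; (ii) there is $k_0\in\mathbb{N}$ such that for all $k\ge k_0$ and all $i\neq j$ in $\{1,\dots,n\}$, $T_i^k(N(T_i^{k+1}))\subset N(T_j)$; (iii) there is $m\in\mathbb{N}$ such that for all $p\ge m$ there is $A=(A_1,\dots,A_n)\in\mathcal{B}_n(X)$ mutually commuting with $T$ with $N(A)=\bigcap_i N(A_i)=\{0\}$ and $\delta_A(N(T^p)\cap R(T^p))\subset R(\delta_{T^p})$. For $\alpha>0$, $\mathcal{K}^e_{n\alpha}(X)$ is the set of $T\in\mathcal{B}_n(X)$ for which there exists $\varepsilon>\alpha$ such that for all $S\in\mathcal{B}_n(X)\cap B(O,\varepsilon)$ mutually commuting with $T$: (i) $T+S$ is essentially Kato; (ii) $\sum_{i=1}^n(T_i^*+S_i^* )R^\infty(T^* )=R^\infty(T^* )$; (iii) $\prod_{i=1}^n(T_i+S_i)\big(R^\infty(T+S)\cap N^\infty(T+S)\big)=R^\infty(T+S)\cap N^\infty(T+S)$; (iv)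 for all $k\in\mathbb{N}$ and $i\in\{1,\dots,n\}$, $R((T_i^*+S_i^* )^k)$ and $R(T_i^{*k})$ are closed in $X^*$; (v) for all $k\in\mathbb{N}$ and $p\in\{1,\dots,n\}$, $R((T+S)^k)$, $\sum_{i=1}^pN(T_i^k)$ and $\sum_{i=1}^pN((T_i+S_i)^k)$ are closed in $X$. $\mathcal{G}_{n\alpha}(X)=\mathcal{K}^e_{n\alpha}(X)\cap\mathcal{C}_n(X)$. $\mathcal{P}(\mathcal{G}_{n\alpha}(X))$ is the set of all $T\in\mathcal{B}_n(X)$ such that $T+S\in\mathcal{G}_{n\alpha}(X)$ for every $S\in\mathcal{G}_{n\alpha}(X)$ mutually commuting with $T$. *)

theory Defs
  imports "HOL-Analysis.Analysis" "HOL-Library.Set_Algebras" "HOL-Library.Extended_Nat"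
begin

section \<open>Complex Banach spaces\<close>

class complex_vector = real_vector +
  fixes scaleC :: "complex \<Rightarrow> 'a \<Rightarrow> 'a"  (infixr \<open>*\<^sub>C\<close> 75)
  assumes scaleC_add_right: "c *\<^sub>C (x + y) = c *\<^sub>C x + c *\<^sub>C y"
    and scaleC_add_left: "(c + d) *\<^sub>C x = c *\<^sub>C x + d *\<^sub>C x"
    and scaleC_scaleC: "c *\<^sub>C d *\<^sub>C x = (c * d) *\<^sub>C x"
    and scaleC_of_real: "of_real r *\<^sub>C x = r *\<^sub>R x"

class complex_normed_vector = complex_vector + real_normed_vector +
  assumes norm_scaleC: "norm (c *\<^sub>C x) = norm c * norm x"

class cbanach = complex_normed_vector + banach

lemma scaleC_one: "1 *\<^sub>C x = (x :: 'a::complex_vector)"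
  using scaleC_of_real[of 1 x] by simp

global_interpretation complex_vector: vector_space "scaleC :: complex \<Rightarrow> 'a \<Rightarrow> 'a::complex_vector"
  defines csubspace = complex_vector.subspace
    and cspan = complex_vector.span
  by unfold_locales (simp_all add: scaleC_add_right scaleC_add_left scaleC_scaleC scaleC_one)

definition cfinite_dim :: "'a::complex_vector set \<Rightarrow> bool" where
  "cfinite_dim V \<longleftrightarrow> (\<exists>B. finite B \<and> cspan B = V)"

instantiation complex :: complex_normed_vector
begin

definition scaleC_complex :: "complex \<Rightarrow> complex \<Rightarrow> complex" where
  "scaleC_complex c z = c * z"

instance
  by standard (auto simp: scaleC_complex_def algebra_simps scaleR_conv_of_real norm_mult)

end

instance complex :: cbanach ..


section \<open>Bounded complex-linear operators\<close>

definition bounded_clinear :: "('a::complex_normed_vector \<Rightarrow> 'b::complex_normed_vector) \<Rightarrow> bool" where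
  "bounded_clinear f \<longleftrightarrow> bounded_linear f \<and> (\<forall>c x. f (c *\<^sub>C x) = c *\<^sub>C f x)"

lemma bounded_clinearI:
  "bounded_linear f \<Longrightarrow> (\<And>c x. f (c *\<^sub>C x) = c *\<^sub>C f x) \<Longrightarrow> bounded_clinear f"
  by (simp add: bounded_clinear_def)

lemma bounded_clinear_bounded_linear: "bounded_clinear f \<Longrightarrow> bounded_linear f"
  and bounded_clinear_scaleC: "bounded_clinear f \<Longrightarrow> f (c *\<^sub>C x) = c *\<^sub>C f x"
  by (simp_all add: bounded_clinear_def)

lemma scaleC_scaleR_commute: "c *\<^sub>C (r *\<^sub>R x) = r *\<^sub>R (c *\<^sub>C (x :: 'a::complex_vector))"
  by (simp add: scaleC_of_real[symmetric] scaleC_scaleC mult.commute)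

lemma bounded_linear_scaleC: "bounded_linear (\<lambda>x :: 'a::complex_normed_vector. c *\<^sub>C x)"
  by (rule bounded_linear_intro[where K = "norm c"])
    (simp_all add: scaleC_add_right scaleC_scaleR_commute norm_scaleC mult.commute)

lemma bounded_clinear_ident: "bounded_clinear (\<lambda>x. x)"
  by (simp add: bounded_clinear_def bounded_linear_ident)

lemma bounded_clinear_compose:
  "bounded_clinear f \<Longrightarrow> bounded_clinear g \<Longrightarrow> bounded_clinear (\<lambda>x. f (g x))"
  by (simp add: bounded_clinear_def bounded_linear_compose)

typedef (overloaded) ('a, 'b) cblinfun  (\<open>(_ \<Rightarrow>\<^sub>C\<^sub>L /_)\<close> [22, 21] 21) =
  "{f :: 'a::complex_normed_vector \<Rightarrow> 'b::complex_normed_vector. bounded_clinear f}"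
  morphisms cblinfun_apply CBlinfun
proof
  show "(\<lambda>x. 0) \<in> {f :: 'a \<Rightarrow> 'b. bounded_clinear f}"
    by (simp add: bounded_clinear_def bounded_linear_zero complex_vector.scale_zero_right)
qed

setup_lifting type_definition_cblinfun

instantiation cblinfun :: (complex_normed_vector, complex_normed_vector) real_normed_vector
begin

lift_definition norm_cblinfun :: "'a \<Rightarrow>\<^sub>C\<^sub>L 'b \<Rightarrow> real" is onorm .

lift_definition minus_cblinfun :: "'a \<Rightarrow>\<^sub>C\<^sub>L 'b \<Rightarrow> 'a \<Rightarrow>\<^sub>C\<^sub>L 'b \<Rightarrow> 'a \<Rightarrow>\<^sub>C\<^sub>L 'b"
  is "\<lambda>f g x. f x - g x"
  by (simp add: bounded_clinear_def bounded_linear_sub complex_vector.scale_right_diff_distrib)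

lift_definition uminus_cblinfun :: "'a \<Rightarrow>\<^sub>C\<^sub>L 'b \<Rightarrow> 'a \<Rightarrow>\<^sub>C\<^sub>L 'b" is "\<lambda>f x. - f x"
  by (simp add: bounded_clinear_def bounded_linear_minus complex_vector.scale_minus_right)

lift_definition zero_cblinfun :: "'a \<Rightarrow>\<^sub>C\<^sub>L 'b" is "\<lambda>x. 0"
  by (simp add: bounded_clinear_def bounded_linear_zero complex_vector.scale_zero_right)

lift_definition plus_cblinfun :: "'a \<Rightarrow>\<^sub>C\<^sub>L 'b \<Rightarrow> 'a \<Rightarrow>\<^sub>C\<^sub>L 'b \<Rightarrow> 'a \<Rightarrow>\<^sub>C\<^sub>L 'b"
  is "\<lambda>f g x. f x + g x"
  by (simp add: bounded_clinear_def bounded_linear_add scaleC_add_right)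

lift_definition scaleR_cblinfun :: "real \<Rightarrow> 'a \<Rightarrow>\<^sub>C\<^sub>L 'b \<Rightarrow> 'a \<Rightarrow>\<^sub>C\<^sub>L 'b" is "\<lambda>r f x. r *\<^sub>R f x"
  by (simp add: bounded_clinear_def bounded_linear_const_scaleR scaleC_scaleR_commute)

definition dist_cblinfun :: "'a \<Rightarrow>\<^sub>C\<^sub>L 'b \<Rightarrow> 'a \<Rightarrow>\<^sub>C\<^sub>L 'b \<Rightarrow> real" where
  "dist_cblinfun a b = norm (a - b)"

definition uniformity_cblinfun :: "(('a \<Rightarrow>\<^sub>C\<^sub>L 'b) \<times> ('a \<Rightarrow>\<^sub>C\<^sub>L 'b)) filter" where
  "uniformity_cblinfun = (INF e\<in>{0 <..}. principal {(x, y). dist x y < e})"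

definition open_cblinfun :: "('a \<Rightarrow>\<^sub>C\<^sub>L 'b) set \<Rightarrow> bool" where
  "open_cblinfun S = (\<forall>x\<in>S. \<forall>\<^sub>F (x', y) in uniformity. x' = x \<longrightarrow> y \<in> S)"

definition sgn_cblinfun :: "'a \<Rightarrow>\<^sub>C\<^sub>L 'b \<Rightarrow> 'a \<Rightarrow>\<^sub>C\<^sub>L 'b" where
  "sgn_cblinfun x = scaleR (inverse (norm x)) x"

instance
proof
  fix f g h :: "'a \<Rightarrow>\<^sub>C\<^sub>L 'b" and a b :: real and U :: "('a \<Rightarrow>\<^sub>C\<^sub>L 'b) set"
  show "f + g + h = f + (g + h)" by transfer (simp add: add.assoc)
  show "f + g = g + f" by transfer (simp add: add.commute)
  show "0 + f = f" by transfer simp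
  show "- f + f = 0" by transfer simp
  show "f - g = f + - g" by transfer simp
  show "a *\<^sub>R (f + g) = a *\<^sub>R f + a *\<^sub>R g" by transfer (simp add: scaleR_add_right)
  show "(a + b) *\<^sub>R f = a *\<^sub>R f + b *\<^sub>R f" by transfer (simp add: scaleR_add_left)
  show "a *\<^sub>R b *\<^sub>R f = (a * b) *\<^sub>R f" by transfer simp
  show "1 *\<^sub>R f = f" by transfer simp
  show "dist f g = norm (f - g)" by (rule dist_cblinfun_def)
  show "sgn f = inverse (norm f) *\<^sub>R f" by (rule sgn_cblinfun_def)
  show "(uniformity :: (('a \<Rightarrow>\<^sub>C\<^sub>L 'b) \<times> ('a \<Rightarrow>\<^sub>C\<^sub>L 'b)) filter) =
      (INF e\<in>{0 <..}. principal {(x, y). dist x y < e})"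
    by (rule uniformity_cblinfun_def)
  show "open U = (\<forall>x\<in>U. \<forall>\<^sub>F (x', y) in uniformity. x' = x \<longrightarrow> y \<in> U)"
    by (rule open_cblinfun_def)
  show "(norm f = 0) = (f = 0)"
    by transfer (simp add: onorm_eq_0 bounded_clinear_bounded_linear fun_eq_iff)
  show "norm (f + g) \<le> norm f + norm g"
    by transfer (simp add: onorm_triangle bounded_clinear_bounded_linear)
  show "norm (a *\<^sub>R f) = \<bar>a\<bar> * norm f"
    by transfer (simp add: onorm_scaleR bounded_clinear_bounded_linear)
qed

end

instantiation cblinfun :: (complex_normed_vector, complex_normed_vector) complex_normed_vector
begin

lift_definition scaleC_cblinfun :: "complex \<Rightarrow> 'a \<Rightarrow>\<^sub>C\<^sub>L 'b \<Rightarrow> 'a \<Rightarrow>\<^sub>C\<^sub>L 'b" is "\<lambda>c f x. c *\<^sub>C f x"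
  by (auto simp: bounded_clinear_def scaleC_scaleC mult.commute
      intro: bounded_linear_compose[OF bounded_linear_scaleC])

instance
proof
  fix c d :: complex and r :: real and f g :: "'a \<Rightarrow>\<^sub>C\<^sub>L 'b"
  show "c *\<^sub>C (f + g) = c *\<^sub>C f + c *\<^sub>C g"
    by transfer (simp add: scaleC_add_right)
  show "(c + d) *\<^sub>C f = c *\<^sub>C f + d *\<^sub>C f"
    by transfer (simp add: scaleC_add_left)
  show "c *\<^sub>C d *\<^sub>C f = (c * d) *\<^sub>C f"
    by transfer (simp add: scaleC_scaleC)
  show "of_real r *\<^sub>C f = r *\<^sub>R f"
    by transfer (simp add: scaleC_of_real)
  show "norm (c *\<^sub>C f) = norm c * norm f"
  proof transfer
    fix c and f :: "'a \<Rightarrow> 'b" assume "bounded_clinear f"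
    then have f: "bounded_linear f" by (rule bounded_clinear_bounded_linear)
    have "onorm (\<lambda>x. c *\<^sub>C f x) = onorm (\<lambda>x. norm c *\<^sub>R f x)"
      by (simp add: onorm_def norm_scaleC)
    also have "\<dots> = norm c * onorm f"
      using onorm_scaleR[OF f, of "norm c"] by simp
    finally show "onorm (\<lambda>x. c *\<^sub>C f x) = norm c * onorm f" .
  qed
qed

end

lift_definition cblinfun_compose ::
  "'b::complex_normed_vector \<Rightarrow>\<^sub>C\<^sub>L 'c::complex_normed_vector \<Rightarrow> 'a::complex_normed_vector \<Rightarrow>\<^sub>C\<^sub>L 'b \<Rightarrow> 'a \<Rightarrow>\<^sub>C\<^sub>L 'c"
  (infixl \<open>o\<^sub>C\<^sub>L\<close> 67) is "\<lambda>f g x. f (g x)"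
  by (rule bounded_clinear_compose)

lift_definition cblinfun_id :: "'a::complex_normed_vector \<Rightarrow>\<^sub>C\<^sub>L 'a" is "\<lambda>x. x"
  by (rule bounded_clinear_ident)

primrec op_pow :: "('a::complex_normed_vector \<Rightarrow>\<^sub>C\<^sub>L 'a) \<Rightarrow> nat \<Rightarrow> 'a \<Rightarrow>\<^sub>C\<^sub>L 'a" where
  "op_pow A 0 = cblinfun_id"
| "op_pow A (Suc k) = A o\<^sub>C\<^sub>L op_pow A k"

definition op_ker :: "('a::complex_normed_vector \<Rightarrow>\<^sub>C\<^sub>L 'b::complex_normed_vector) \<Rightarrow> 'a set" where
  "op_ker A = {x. cblinfun_apply A x = 0}"

definition op_ran :: "('a::complex_normed_vector \<Rightarrow>\<^sub>C\<^sub>L 'b::complex_normed_vector) \<Rightarrow> 'b set" where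
  "op_ran A = range (cblinfun_apply A)"

type_synonym 'a cdual = "'a \<Rightarrow>\<^sub>C\<^sub>L complex"

text \<open>The dual operator is taken without conjugation, as usual for Banach spaces.\<close>

definition dual_op :: "('a::complex_normed_vector \<Rightarrow>\<^sub>C\<^sub>L 'a) \<Rightarrow> 'a cdual \<Rightarrow>\<^sub>C\<^sub>L 'a cdual" where
  "dual_op A = CBlinfun (\<lambda>f. f o\<^sub>C\<^sub>L A)"

lemma dual_op_apply: "cblinfun_apply (dual_op A) f = f o\<^sub>C\<^sub>L A"
proof -
  have "bounded_clinear (\<lambda>f :: 'a cdual. f o\<^sub>C\<^sub>L A)"
  proof (rule bounded_clinearI)
    show "bounded_linear (\<lambda>f :: 'a cdual. f o\<^sub>C\<^sub>L A)"
    proof (rule bounded_linear_intro)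
      fix f g :: "'a cdual" and r :: real
      show "(f + g) o\<^sub>C\<^sub>L A = (f o\<^sub>C\<^sub>L A) + (g o\<^sub>C\<^sub>L A)" by transfer simp
      show "(r *\<^sub>R f) o\<^sub>C\<^sub>L A = r *\<^sub>R (f o\<^sub>C\<^sub>L A)" by transfer simp
      show "norm (f o\<^sub>C\<^sub>L A) \<le> norm f * norm A"
      proof transfer
        fix f :: "'a \<Rightarrow> complex" and A :: "'a \<Rightarrow> 'a"
        assume "bounded_clinear f" "bounded_clinear A"
        then show "onorm (\<lambda>x. f (A x)) \<le> onorm f * onorm A"
          using onorm_compose[of f A] by (simp add: bounded_clinear_bounded_linear o_def)
      qed
    qed
    show "(c *\<^sub>C f) o\<^sub>C\<^sub>L A = c *\<^sub>C (f o\<^sub>C\<^sub>L A)" for c and f :: "'a cdual"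
      by transfer simp
  qed
  then show ?thesis by (simp add: dual_op_def CBlinfun_inverse)
qed


section \<open>Tuples of operators\<close>

text \<open>
  An \<open>n\<close>-tuple of operators is a vector over a finite linearly ordered index type \<open>'n\<close>, which
  plays the role of \<open>{1, \<dots>, n}\<close> with \<open>n = CARD('n) \<ge> 1\<close>. Sums of tuples and the zero tuple are
  the componentwise ones of \<open>vec\<close>, and \<open>X^n\<close> is \<open>'a ^ 'n\<close>. Sums of sets are Minkowski sums.
\<close>

type_synonym ('a, 'n) op_tuple = "('a \<Rightarrow>\<^sub>C\<^sub>L 'a) ^ 'n"

definition mutually_commuting ::
  "('a::complex_normed_vector, 'n::finite) op_tuple \<Rightarrow> ('a, 'n) op_tuple \<Rightarrow> bool" where
  "mutually_commuting T S \<longleftrightarrow> (\<forall>i j. T $ i o\<^sub>C\<^sub>L S $ j = S $ j o\<^sub>C\<^sub>L T $ i)"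

definition commuting_tuples :: "('a::complex_normed_vector, 'n::finite) op_tuple set" where
  "commuting_tuples = {T. \<forall>i j. T $ i o\<^sub>C\<^sub>L T $ j = T $ j o\<^sub>C\<^sub>L T $ i}"

definition tuple_pow ::
  "('a::complex_normed_vector, 'n::finite) op_tuple \<Rightarrow> nat \<Rightarrow> ('a, 'n) op_tuple" where
  "tuple_pow T k = (\<chi> i. op_pow (T $ i) k)"

definition tuple_dual ::
  "('a::complex_normed_vector, 'n::finite) op_tuple \<Rightarrow> ('a cdual, 'n) op_tuple" where
  "tuple_dual T = (\<chi> i. dual_op (T $ i))"

definition tuple_ker :: "('a::complex_normed_vector, 'n::finite) op_tuple \<Rightarrow> 'a set" where
  "tuple_ker T = (\<Inter>i. op_ker (T $ i))"

definition tuple_ran :: "('a::complex_normed_vector, 'n::finite) op_tuple \<Rightarrow> 'a set" where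
  "tuple_ran T = (\<Sum>i\<in>UNIV. op_ran (T $ i))"

definition tuple_ker_inf :: "('a::complex_normed_vector, 'n::finite) op_tuple \<Rightarrow> 'a set" where
  "tuple_ker_inf T = (\<Union>k. tuple_ker (tuple_pow T k))"

definition tuple_ran_inf :: "('a::complex_normed_vector, 'n::finite) op_tuple \<Rightarrow> 'a set" where
  "tuple_ran_inf T = (\<Inter>k. tuple_ran (tuple_pow T k))"

definition tuple_norm :: "('a::complex_normed_vector, 'n::finite) op_tuple \<Rightarrow> real" where
  "tuple_norm T = (\<Sum>i\<in>UNIV. norm (T $ i))"

text \<open>The product \<open>T\<^sub>1 \<dots> T\<^sub>n\<close>, in the order of the index type.\<close>

definition tuple_prod ::
  "('a::complex_normed_vector, 'n::{finite,linorder}) op_tuple \<Rightarrow> 'a \<Rightarrow>\<^sub>C\<^sub>L 'a" where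
  "tuple_prod T = foldr (\<lambda>i A. T $ i o\<^sub>C\<^sub>L A) (sorted_list_of_set UNIV) cblinfun_id"

definition delta :: "('a::complex_normed_vector, 'n::finite) op_tuple \<Rightarrow> 'a \<Rightarrow> 'a ^ 'n" where
  "delta T x = (\<chi> i. cblinfun_apply (T $ i) x)"

definition ascent :: "('a::complex_normed_vector, 'n::finite) op_tuple \<Rightarrow> enat" where
  "ascent T =
    (if \<exists>k. tuple_ker (tuple_pow T k) = tuple_ker (tuple_pow T (k + 1))
     then enat (LEAST k. tuple_ker (tuple_pow T k) = tuple_ker (tuple_pow T (k + 1)))
     else \<infinity>)"


section \<open>The classes of tuples\<close>

definition Phi_plus :: "('a::complex_normed_vector, 'n::finite) op_tuple set" where
  "Phi_plus = {T \<in> commuting_tuples. cfinite_dim (tuple_ker T) \<and> closed (range (delta T))}"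

definition essentially_Kato :: "('a::complex_normed_vector, 'n::finite) op_tuple \<Rightarrow> bool" where
  "essentially_Kato T \<longleftrightarrow>
    T \<in> commuting_tuples \<and> closed (tuple_ran T) \<and>
    (\<exists>F. csubspace F \<and> cfinite_dim F \<and> F \<subseteq> tuple_ker_inf T \<and>
         tuple_ker_inf T \<subseteq> tuple_ran_inf T + F)"

definition C_class :: "('a::complex_normed_vector, 'n::finite) op_tuple set" where
  "C_class = {T \<in> commuting_tuples.
    T \<in> Phi_plus \<and>
    (\<exists>k0. \<forall>k\<ge>k0. \<forall>i j. i \<noteq> j \<longrightarrow>
       cblinfun_apply (op_pow (T $ i) k) ` op_ker (op_pow (T $ i) (k + 1)) \<subseteq> op_ker (T $ j)) \<and>
    (\<exists>m. \<forall>p\<ge>m. \<exists>A \<in> commuting_tuples. mutually_commuting A T \<and> tuple_ker A = {0} \<and>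
       delta A ` (tuple_ker (tuple_pow T p) \<inter> tuple_ran (tuple_pow T p))
         \<subseteq> range (delta (tuple_pow T p)))}"

definition K_class ::
  "real \<Rightarrow> ('a::complex_normed_vector, 'n::{finite,linorder}) op_tuple set" where
  "K_class \<alpha> = {T \<in> commuting_tuples. \<exists>\<epsilon>>\<alpha>. \<forall>S \<in> commuting_tuples.
    tuple_norm S < \<epsilon> \<and> mutually_commuting T S \<longrightarrow>
      essentially_Kato (T + S) \<and>
      (\<Sum>i\<in>UNIV. cblinfun_apply (dual_op (T $ i) + dual_op (S $ i)) ` tuple_ran_inf (tuple_dual T))
        = tuple_ran_inf (tuple_dual T) \<and>
      cblinfun_apply (tuple_prod (T + S)) ` (tuple_ran_inf (T + S) \<inter> tuple_ker_inf (T + S))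
        = tuple_ran_inf (T + S) \<inter> tuple_ker_inf (T + S) \<and>
      (\<forall>k i. closed (op_ran (op_pow (dual_op (T $ i) + dual_op (S $ i)) k)) \<and>
             closed (op_ran (op_pow (dual_op (T $ i)) k))) \<and>
      (\<forall>k p. closed (tuple_ran (tuple_pow (T + S) k)) \<and>
             closed (\<Sum>i\<in>{..p}. op_ker (op_pow (T $ i) k)) \<and>
             closed (\<Sum>i\<in>{..p}. op_ker (op_pow (T $ i + S $ i) k)))}"

definition G_class ::
  "real \<Rightarrow> ('a::complex_normed_vector, 'n::{finite,linorder}) op_tuple set" where
  "G_class \<alpha> = K_class \<alpha> \<inter> C_class"

definition perturbation_class ::
  "('a::complex_normed_vector, 'n::finite) op_tuple set \<Rightarrow> ('a, 'n) op_tuple set" where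
  "perturbation_class \<G> =
    {T \<in> commuting_tuples. \<forall>S \<in> \<G>. mutually_commuting T S \<longrightarrow> T + S \<in> \<G>}"

end

theory Submission
  imports Defs
begin

text \<open>
  Finite ascent is carried from \<open>T\<close> to \<open>T + S\<close> along the tuples \<open>W\<^sub>r = r T + S\<close>, where \<open>r\<close> decreases
  from a large \<open>L\<close> to \<open>1\<close>. Multiplication by \<open>r \<ge> 1\<close> preserves the class \<open>\<G>\<^sub>\<alpha>\<close>
  (\<open>G_class_scaleR\<close>), and \<open>S\<close> perturbs this class into itself, so every \<open>W\<^sub>r\<close> belongs to \<open>\<G>\<^sub>\<alpha>\<close>.
  Hence the conditions that define \<open>\<K>\<^sub>\<alpha>\<close> hold around each \<open>W\<^sub>r\<close> on a ball of one and the same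
  radius, finitely many steps of norm at most \<open>\<alpha>\<close> lead from \<open>W\<^sub>L\<close> to \<open>W\<^sub>1 = T + S\<close>, and it is enough
  to know that one such step preserves finite ascent. The path is entered by the same kind of step:
  \<open>L T\<close> lies in \<open>\<K>\<^sub>\<beta>\<close> with \<open>\<beta> = L \<alpha>\<close>, and \<open>W\<^sub>L\<close> differs from it by \<open>S\<close>, of norm at most \<open>\<beta>\<close> when
  \<open>L\<close> is large.

  One step (\<open>ascent_finite_add\<close>). Let \<open>W\<close> have finite ascent, and let \<open>V\<close> be a small commuting
  perturbation. Let \<open>N = N(W\<^sup>p) = N(W\<^sup>p\<^sup>+\<^sup>1)\<close>; this space is finite-dimensional because \<open>N(W)\<close> is.
  A tuple \<open>W\<close> in \<open>\<Phi>\<^sub>+\<close> with finite ascent satisfies \<open>R\<^sup>\<infinity>(W\<^sup>*) = N\<^sup>\<bottom>\<close>, the annihilator of \<open>N\<close>.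
  So the requirement that the operators \<open>W\<^sub>i\<^sup>* + V\<^sub>i\<^sup>*\<close> map \<open>R\<^sup>\<infinity>(W\<^sup>*)\<close> onto itself says
  that every functional \<open>f\<close> vanishing on \<open>N\<close> has the form \<open>\<Sum>\<^sub>i g\<^sub>i \<circ> (W\<^sub>i + V\<^sub>i)\<close> with \<open>g\<^sub>i\<close> vanishing on
  \<open>N\<close>. If all \<open>(W\<^sub>i + V\<^sub>i) x\<close> lie in \<open>N\<close>, all these \<open>f\<close> vanish at \<open>x\<close>, and \<open>x \<in> N\<close> by the
  Hahn-Banach theorem. Therefore \<open>N\<^sup>\<infinity>(W + V) \<subseteq> N\<close>, and an increasing sequence of subspaces of a
  finite-dimensional space stops growing.

  The inclusion \<open>N\<^sup>\<bottom> \<subseteq> R\<^sup>\<infinity>(W\<^sup>*)\<close> is where closed range enters. The open mapping theorem for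
  \<open>(x, z) \<mapsto> \<delta>\<^sub>W x + z\<close> on \<open>X \<times> N\<^sup>n\<close> bounds the distance from \<open>x\<close> to \<open>N\<close> by the distances from
  the \<open>W\<^sub>i x\<close> to \<open>N\<close>, and iteration gives \<open>dist(x, N) \<le> C\<^sub>k \<Sum>\<^sub>i \<parallel>W\<^sub>i\<^sup>k x\<parallel>\<close>. So \<open>|f x|\<close> is at most a
  multiple of \<open>\<Sum>\<^sub>i \<parallel>W\<^sub>i\<^sup>k x\<parallel>\<close> whenever \<open>f\<close> vanishes on \<open>N\<close>, and \<open>f\<close> factors through \<open>x \<mapsto> (W\<^sub>i\<^sup>k x)\<^sub>i\<close>,
  again by Hahn-Banach.

  All passages from the operators \<open>W\<^sub>i\<close> to their powers are instances of \<open>commuting_Nakayama\<close>.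
\<close>

section \<open>Powers of commuting maps\<close>

lemma funpow_commuting:
  assumes "\<And>x. f (g x) = g (f x)"
  shows "(f ^^ k) (g x) = g ((f ^^ k) x)"
  by (induction k) (simp_all add: assms)

text \<open>
  Were \<open>x\<close> outside \<open>Z\<close>, a monomial of maximal degree in the \<open>W i\<close> that keeps \<open>x\<close> outside \<open>Z\<close> would
  contradict \<open>step\<close>; such a monomial exists because \<open>powers\<close> bounds the degree. This is the dual of
  Nakayama's lemma for a nilpotent ideal. Points and \<open>Z\<close> are completely general, since \<open>W i\<close> will
  act below on vectors, on sets by taking images, and on maps by composition.
\<close>

lemma commuting_Nakayama:
  fixes W :: "'n::finite \<Rightarrow> 'a \<Rightarrow> 'a"
  assumes comm: "\<And>i j x. W i (W j x) = W j (W i x)"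
    and inv: "\<And>i x. x \<in> Z \<Longrightarrow> W i x \<in> Z"
    and step: "\<And>x. (\<And>i. W i x \<in> Z) \<Longrightarrow> x \<in> Z"
    and powers: "\<And>i. (W i ^^ k i) x \<in> Z"
  shows "x \<in> Z"
proof -
  have "x \<in> Z" if "finite J" "\<And>i. i \<in> J \<Longrightarrow> (W i ^^ k i) x \<in> Z" "\<And>i. i \<notin> J \<Longrightarrow> W i x \<in> Z" for J x
    using that
  proof (induction J arbitrary: x)
    case (insert j J)
    have "x \<in> Z" if "(W j ^^ m) x \<in> Z" "\<And>i. i \<in> J \<Longrightarrow> (W i ^^ k i) x \<in> Z"
      "\<And>i. i \<notin> insert j J \<Longrightarrow> W i x \<in> Z" for m x
      using that
    proof (induction m arbitrary: x)
      case (Suc m)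
      have "W j x \<in> Z"
      proof (rule Suc.IH)
        show "(W j ^^ m) (W j x) \<in> Z" using Suc.prems(1) by (simp add: funpow_swap1)
        show "(W i ^^ k i) (W j x) \<in> Z" if "i \<in> J" for i
          using Suc.prems(2)[OF that] inv by (subst funpow_commuting) (auto intro: comm)
        show "W i (W j x) \<in> Z" if "i \<notin> insert j J" for i
          using inv[OF Suc.prems(3)[OF that], of j] comm[of i j x] by simp
      qed
      then show ?case using Suc.prems insert.IH by (metis insertE)
    qed simp
    then show ?case using insert.prems by (meson insertCI)
  qed (auto intro: step)
  from this[of UNIV] powers show ?thesis by simp
qed

section \<open>The Hahn-Banach theorem in the form of Mazur and Orlicz\<close>

definition sublinear :: "('a::real_vector \<Rightarrow> real) \<Rightarrow> bool" where
  "sublinear p \<longleftrightarrow> (\<forall>x y. p (x + y) \<le> p x + p y) \<and> (\<forall>t\<ge>0. \<forall>x. p (t *\<^sub>R x) = t * p x)"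

lemma sublinear_add: "sublinear p \<Longrightarrow> p (x + y) \<le> p x + p y"
  and sublinear_scale: "sublinear p \<Longrightarrow> 0 \<le> t \<Longrightarrow> p (t *\<^sub>R x) = t * p x"
  by (auto simp: sublinear_def)

lemma sublinear_zero: "sublinear p \<Longrightarrow> p 0 = 0"
  using sublinear_scale[of p 0 0] by simp

lemma sublinear_minus_le: "sublinear p \<Longrightarrow> - p (- x) \<le> p x"
  using sublinear_add[of p x "- x"] sublinear_zero[of p] by simp

text \<open>
  The Mazur-Orlicz construction: the infimum of \<open>p (y + v) - s\<close> over the cone is the largest sublinear
  functional satisfying the last inequality. That inequality at \<open>y = - v\<close> yields \<open>s \<le> - q (- v)\<close>,
  so every linear functional below \<open>q\<close> automatically dominates the prescribed values on the cone.
\<close>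

lemma sublinear_shrink_along_cone:
  fixes p :: "'a::real_vector \<Rightarrow> real" and C :: "('a \<times> real) set"
  assumes p: "sublinear p" and C: "convex_cone C"
    and le: "\<And>v s. (v, s) \<in> C \<Longrightarrow> s \<le> p v"
  shows "\<exists>q. sublinear q \<and> q \<le> p \<and> (\<forall>y. \<forall>(v, s)\<in>C. q y \<le> p (y + v) - s)"
proof -
  define q where "q y = (INF c\<in>C. p (y + fst c) - snd c)" for y
  have zero: "0 \<in> C" using C by (simp add: convex_cone_iff)
  have bdd: "bdd_below ((\<lambda>c. p (y + fst c) - snd c) ` C)" for y
  proof (rule bdd_belowI2)
    fix c assume c: "c \<in> C"
    have "p (fst c) \<le> p (y + fst c) + p (- y)"
      using sublinear_add[OF p, of "y + fst c" "- y"] by simp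
    with le[of "fst c" "snd c"] c show "- p (- y) \<le> p (y + fst c) - snd c" by simp
  qed
  have q_le: "q y \<le> p (y + fst c) - snd c" if "c \<in> C" for y c
    unfolding q_def by (rule cINF_lower[OF bdd that])
  have q_ge: "m \<le> q y" if "\<And>c. c \<in> C \<Longrightarrow> m \<le> p (y + fst c) - snd c" for m y
    unfolding q_def using zero that by (intro cINF_greatest) auto
  have add: "q (x + y) \<le> q x + q y" for x y
  proof -
    have *: "q (x + y) - (p (x + fst c) - snd c) \<le> p (y + fst d) - snd d"
      if "c \<in> C" "d \<in> C" for c d
    proof -
      have "c + d \<in> C" using that C by (simp add: convex_cone_iff)
      from q_le[OF this, of "x + y"]
      have "q (x + y) \<le> p ((x + fst c) + (y + fst d)) - (snd c + snd d)"
        by (simp add: algebra_simps)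
      with sublinear_add[OF p, of "x + fst c" "y + fst d"] show ?thesis by linarith
    qed
    have "q (x + y) - (p (x + fst c) - snd c) \<le> q y" if "c \<in> C" for c
      using *[OF that] by (rule q_ge)
    then have "q (x + y) - q y \<le> q x" by (intro q_ge) (smt (verit, best))
    then show ?thesis by simp
  qed
  have scale_le: "q (t *\<^sub>R y) \<le> t * q y" if "0 < t" for t y
  proof -
    have "q (t *\<^sub>R y) / t \<le> q y"
    proof (rule q_ge)
      fix c assume "c \<in> C"
      then have "t *\<^sub>R c \<in> C" using C that by (simp add: convex_cone_iff)
      from q_le[OF this, of "t *\<^sub>R y"]
      have "q (t *\<^sub>R y) \<le> p (t *\<^sub>R (y + fst c)) - t * snd c" by (simp add: scaleR_add_right)
      also have "\<dots> = t * (p (y + fst c) - snd c)"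
        using sublinear_scale[OF p] that by (simp add: right_diff_distrib)
      finally show "q (t *\<^sub>R y) / t \<le> p (y + fst c) - snd c"
        using that by (simp add: field_simps)
    qed
    then show ?thesis using that by (simp add: field_simps)
  qed
  have scale_pos: "q (t *\<^sub>R y) = t * q y" if "0 < t" for t y
    using scale_le[OF that, of y] scale_le[of "1 / t" "t *\<^sub>R y"] that by (simp add: field_simps)
  have q_le_p: "q \<le> p"
    using q_le[OF zero] by (simp add: le_fun_def)
  have "q 0 = 0"
    using scale_pos[of 2 0] by simp
  then have "sublinear q"
    unfolding sublinear_def using add scale_pos by (metis less_eq_real_def mult_zero_left scale_zero_left)
  then show ?thesis using q_le_p q_le by fastforce
qed

lemma minimal_sublinear_below:
  fixes p :: "'a::real_vector \<Rightarrow> real"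
  assumes p: "sublinear p"
  shows "\<exists>q. sublinear q \<and> q \<le> p \<and> (\<forall>q'. sublinear q' \<and> q' \<le> q \<longrightarrow> q' = q)"
proof -
  define S where "S = {q. sublinear q \<and> q \<le> p}"
  have "\<exists>m\<in>S. \<forall>a\<in>S. m \<ge> a \<longrightarrow> a = m"
  proof (rule predicate_Zorn)
    show "partial_order_on S (relation_of (\<lambda>a b. a \<ge> b) S)"
      by (auto simp: partial_order_on_def preorder_on_def refl_on_def trans_def antisym_def
          relation_of_def)
    fix K assume K: "K \<in> Chains (relation_of (\<lambda>a b. a \<ge> b) S)"
    have KS: "K \<subseteq> S" and chain: "\<And>a b. a \<in> K \<Longrightarrow> b \<in> K \<Longrightarrow> a \<le> b \<or> b \<le> a"
      using K by (auto simp: Chains_def relation_of_def)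
    show "\<exists>u\<in>S. \<forall>a\<in>K. a \<ge> u"
    proof (cases "K = {}")
      case True
      then show ?thesis using p by (auto simp: S_def)
    next
      case False
      define u where "u x = (INF a\<in>K. a x)" for x
      have sub: "sublinear a" and le_p: "a x \<le> p x" if "a \<in> K" for a x
        using KS that by (auto simp: S_def le_fun_def)
      \<comment> \<open>All members of the chain lie above the same superlinear functional, so the infimum is finite.\<close>
      have bdd: "bdd_below ((\<lambda>a. a x) ` K)" for x
      proof (rule bdd_belowI2)
        fix a assume a: "a \<in> K"
        show "- p (- x) \<le> a x"
          using sublinear_minus_le[OF sub[OF a], of x] le_p[OF a, of "- x"] by simp
      qed
      have u_le: "u x \<le> a x" if "a \<in> K" for a x
        unfolding u_def by (rule cINF_lower[OF bdd that])
      have u_ge: "m \<le> u x" if "\<And>a. a \<in> K \<Longrightarrow> m \<le> a x" for m x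
        unfolding u_def using False that by (intro cINF_greatest) auto
      have "u (x + y) \<le> u x + u y" for x y
      proof -
        have *: "u (x + y) - a x \<le> b y" if "a \<in> K" "b \<in> K" for a b
          using chain[OF that] u_le[OF that(1), of "x + y"] u_le[OF that(2), of "x + y"]
            sublinear_add[OF sub[OF that(1)], of x y] sublinear_add[OF sub[OF that(2)], of x y]
          by (smt (verit) le_fun_def)
        have "u (x + y) - a x \<le> u y" if "a \<in> K" for a
          using *[OF that] by (rule u_ge)
        then have "u (x + y) - u y \<le> u x" by (intro u_ge) (smt (verit, best))
        then show ?thesis by simp
      qed
      moreover have "u (t *\<^sub>R x) = t * u x" if "0 \<le> t" for t x
      proof (cases "t = 0")
        case True
        have "(\<lambda>a. a 0) ` K = {0}" using False sublinear_zero[OF sub] by force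
        with True show ?thesis by (simp add: u_def)
      next
        case ne: False
        then have t: "0 < t" using that by simp
        have "u (t *\<^sub>R x) / t \<le> u x"
        proof (rule u_ge)
          fix a assume a: "a \<in> K"
          show "u (t *\<^sub>R x) / t \<le> a x"
            using u_le[OF a, of "t *\<^sub>R x"] sublinear_scale[OF sub[OF a] that, of x] t
            by (simp add: field_simps)
        qed
        moreover have "t * u x \<le> u (t *\<^sub>R x)"
        proof (rule u_ge)
          fix a assume a: "a \<in> K"
          show "t * u x \<le> a (t *\<^sub>R x)"
            using u_le[OF a, of x] sublinear_scale[OF sub[OF a] that, of x] t by simp
        qed
        ultimately show ?thesis using t by (simp add: field_simps)
      qed
      ultimately have "sublinear u" by (simp add: sublinear_def)
      moreover have "u \<le> p" using False u_le le_p by (meson all_not_in_conv le_funI order_trans)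
      ultimately show ?thesis using u_le by (auto simp: S_def le_fun_def)
    qed
  qed
  then show ?thesis unfolding S_def by (blast intro: order_trans)
qed

text \<open>
  Shrinking \<open>q\<close> along the single ray through \<open>(a, q a)\<close> cannot change a minimal \<open>q\<close>, which makes \<open>q\<close>
  superadditive.
\<close>

lemma minimal_sublinear_linear:
  fixes q :: "'a::real_vector \<Rightarrow> real"
  assumes q: "sublinear q" and min: "\<And>q'. sublinear q' \<Longrightarrow> q' \<le> q \<Longrightarrow> q' = q"
  shows "linear q"
proof -
  have superadd: "q y + q a \<le> q (y + a)" for y a
  proof -
    let ?C = "(\<lambda>t. (t *\<^sub>R a, t * q a)) ` {0..}"
    have cone: "convex_cone ?C"
      unfolding convex_cone_iff
    proof (intro conjI ballI allI impI)
      show "0 \<in> ?C" by (rule image_eqI[of _ _ 0]) (auto simp: zero_prod_def)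
    next
      fix x y assume "x \<in> ?C" "y \<in> ?C"
      then obtain s t where "0 \<le> s" "0 \<le> t" "x = (s *\<^sub>R a, s * q a)" "y = (t *\<^sub>R a, t * q a)"
        by auto
      then show "x + y \<in> ?C"
        by (intro image_eqI[of _ _ "s + t"]) (auto simp: algebra_simps)
    next
      fix x and c :: real assume "x \<in> ?C" "0 \<le> c"
      then obtain s where "0 \<le> s" "x = (s *\<^sub>R a, s * q a)"
        by auto
      then show "c *\<^sub>R x \<in> ?C" using \<open>0 \<le> c\<close>
        by (intro image_eqI[of _ _ "c * s"]) auto
    qed
    have "s \<le> q v" if "(v, s) \<in> ?C" for v s
      using that sublinear_scale[OF q] by auto
    from sublinear_shrink_along_cone[OF q cone this] obtain q' where
      "sublinear q'" "q' \<le> q" and q': "\<And>y v s. (v, s) \<in> ?C \<Longrightarrow> q' y \<le> q (y + v) - s"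
      by blast
    with min have "q' = q" by blast
    with q'[of a "q a" y] show ?thesis by (force simp: image_iff)
  qed
  have add: "q (x + y) = q x + q y" for x y
    using superadd[of x y] sublinear_add[OF q, of x y] by simp
  have minus: "q (- x) = - q x" for x
    using add[of x "- x"] sublinear_zero[OF q] by simp
  show ?thesis
  proof (rule linearI)
    show "q (c *\<^sub>R x) = c *\<^sub>R q x" for c x
    proof (cases "0 \<le> c")
      case True
      then show ?thesis using sublinear_scale[OF q] by simp
    next
      case False
      then show ?thesis
        using sublinear_scale[OF q, of "- c" x] minus[of "c *\<^sub>R x"] by simp
    qed
  qed (rule add)
qed

text \<open>
  This version of the Hahn-Banach theorem prescribes lower bounds on a cone of pairs, so that
  extension, factorization and separation are three choices of the cone and no partially defined
  functionals occur.
\<close>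

theorem Mazur_Orlicz:
  fixes p :: "'a::real_vector \<Rightarrow> real" and C :: "('a \<times> real) set"
  assumes "sublinear p" and "convex_cone C"
    and "\<And>v s. (v, s) \<in> C \<Longrightarrow> s \<le> p v"
  shows "\<exists>u. linear u \<and> (\<forall>x. u x \<le> p x) \<and> (\<forall>(v, s)\<in>C. s \<le> u v)"
proof -
  from sublinear_shrink_along_cone[OF assms] obtain q where
    q: "sublinear q" "q \<le> p" and qC: "\<And>y v s. (v, s) \<in> C \<Longrightarrow> q y \<le> p (y + v) - s"
    by blast
  from minimal_sublinear_below[OF q(1)] obtain u where
    u: "sublinear u" "u \<le> q" and min: "\<And>q'. sublinear q' \<Longrightarrow> q' \<le> u \<Longrightarrow> q' = u" by blast
  have lin: "linear u" using minimal_sublinear_linear[OF u(1) min] .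
  show ?thesis
  proof (intro exI[of _ u] conjI allI ballI case_prodI2 lin)
    show "u x \<le> p x" for x using u(2) q(2) by (meson le_funD order_trans)
  next
    fix c v s assume "c \<in> C" "c = (v, s)"
    then have vs: "(v, s) \<in> C" by simp
    have "u (- v) \<le> q (- v)" using u(2) by (simp add: le_fun_def)
    also have "\<dots> \<le> p (- v + v) - s" by (rule qC[OF vs])
    finally have "- u v \<le> - s"
      using linear_neg[OF lin] sublinear_zero[OF assms(1)] by simp
    then show "s \<le> u v" by simp
  qed
qed

lemma sublinear_scaled_norm: "0 \<le> K \<Longrightarrow> sublinear (\<lambda>x :: 'a::real_normed_vector. K * norm x)"
  unfolding sublinear_def distrib_left[symmetric] by (auto intro: mult_left_mono norm_triangle_ineq)

lemma linear_bounded_by_norm: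
  fixes u :: "'a::real_normed_vector \<Rightarrow> real"
  assumes lin: "linear u" and le: "\<And>x. u x \<le> K * norm x"
  shows "bounded_linear u"
proof -
  have "norm (u x) \<le> norm x * K" for x
    using le[of x] le[of "- x"] linear_neg[OF lin, of x] by (simp add: abs_le_iff mult.commute)
  then show ?thesis
    using lin by (intro bounded_linear_intro[of _ K]) (auto simp: linear_add linear_scale)
qed

text \<open>
  On the range of \<open>L\<close> the functional is forced to be \<open>h\<close>. The cone is the subspace of all pairs
  \<open>(L x, h x)\<close>; a linear lower bound on a subspace is attained.
\<close>

lemma functional_factors_through:
  fixes L :: "'a::real_vector \<Rightarrow> 'b::real_normed_vector" and h :: "'a \<Rightarrow> real"
  assumes L: "linear L" and h: "linear h" and "0 \<le> K" and h_le: "\<And>x. h x \<le> K * norm (L x)"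
  obtains u where "bounded_linear u" "\<And>x. u (L x) = h x"
proof -
  let ?C = "range (\<lambda>x. (L x, h x))"
  have "linear (\<lambda>x. (L x, h x))"
    using L h by (simp add: linear_iff)
  then have cone: "convex_cone ?C"
    by (intro subspace_imp_convex_cone linear_subspace_image subspace_UNIV)
  have le: "s \<le> K * norm v" if "(v, s) \<in> ?C" for v s
    using that h_le by auto
  obtain u where u: "linear u" "\<And>x. u x \<le> K * norm x"
    and uC: "\<And>v s. (v, s) \<in> ?C \<Longrightarrow> s \<le> u v"
    using Mazur_Orlicz[OF sublinear_scaled_norm[OF \<open>0 \<le> K\<close>] cone le] by blast
  have ge: "h x \<le> u (L x)" for x
    using uC[of "L x" "h x"] by blast
  have "u (L x) = h x" for x
    using ge[of x] ge[of "- x"] by (simp add: linear_neg[OF L] linear_neg[OF h] linear_neg[OF u(1)])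
  with linear_bounded_by_norm[OF u] show ?thesis by (rule that)
qed

text \<open>
  On the vectors \<open>t *\<^sub>R x + v\<close> with \<open>t \<ge> 0\<close> and \<open>v \<in> N\<close> the value at least \<open>t * r\<close> is prescribed,
  where \<open>r\<close> is a lower bound for the distance from \<open>x\<close> to \<open>N\<close>. This forces nonnegativity, hence
  vanishing, on the subspace \<open>N\<close>.
\<close>

lemma functional_separating_point_from_closed_subspace:
  fixes N :: "'a::real_normed_vector set"
  assumes N: "subspace N" "closed N" and x: "x \<notin> N"
  obtains u :: "'a \<Rightarrow> real" where "bounded_linear u" "\<And>v. v \<in> N \<Longrightarrow> u v = 0" "u x \<noteq> 0"
proof -
  obtain r where r: "r > 0" "\<And>v. v \<in> N \<Longrightarrow> r \<le> norm (x - v)"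
  proof -
    from N(2) x obtain r where "r > 0" "ball x r \<inter> N = {}"
      by (meson Compl_iff disjoint_eq_subset_Compl open_Compl open_contains_ball)
    then show ?thesis by (intro that[of r]) (force simp: disjoint_iff dist_norm not_less)+
  qed
  let ?C = "(\<lambda>(t, v). (t *\<^sub>R x + v, t * r)) ` ({0..} \<times> N)"
  have cone: "convex_cone ?C"
  proof (intro convex_cone_linear_image conjI)
    show "convex_cone ({0 :: real..} \<times> N)"
      by (rule convex_cone_Times[OF _ subspace_imp_convex_cone[OF N(1)]]) (simp add: convex_cone_iff)
    show "linear (\<lambda>(t, v). (t *\<^sub>R x + v, t * r))"
      by (auto simp: linear_iff algebra_simps)
  qed
  have le: "s \<le> 1 * norm w" if ws: "(w, s) \<in> ?C" for w s
  proof -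
    from ws obtain t v where t: "0 \<le> t" and v: "v \<in> N" and w: "w = t *\<^sub>R x + v" and s: "s = t * r"
      by auto
    show ?thesis
    proof (cases "t = 0")
      case False
      have "r \<le> norm (x - (- (1 / t)) *\<^sub>R v)"
        by (rule r(2)) (rule subspace_scale[OF N(1) v])
      then have "t * r \<le> t * norm (x - (- (1 / t)) *\<^sub>R v)"
        using t by (rule mult_left_mono)
      also have "\<dots> = norm (t *\<^sub>R (x - (- (1 / t)) *\<^sub>R v))"
        using t by simp
      also have "\<dots> = norm w"
        using False by (simp add: w scaleR_add_right del: norm_scaleR)
      finally show ?thesis by (simp add: s)
    qed (simp add: s)
  qed
  obtain u where u: "linear u" "\<And>x. u x \<le> 1 * norm x"
    and uC: "\<And>v s. (v, s) \<in> ?C \<Longrightarrow> s \<le> u v"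
    using Mazur_Orlicz[OF sublinear_scaled_norm[OF zero_le_one] cone le] by blast
  have ge: "0 \<le> u v" if "v \<in> N" for v
    using that by (intro uC) (auto intro!: image_eqI[of _ _ "(0, v)"])
  have "u v = 0" if "v \<in> N" for v
    using ge[OF that] ge[OF subspace_neg[OF N(1) that]] by (simp add: linear_neg[OF u(1)])
  moreover have "r \<le> u x"
    using subspace_0[OF N(1)] by (intro uC) (auto intro!: image_eqI[of _ _ "(1, 0)"])
  ultimately show ?thesis
    using that[OF linear_bounded_by_norm[OF u]] r(1) by fastforce
qed

section \<open>Open mappings and finite-dimensional perturbations of closed subspaces\<close>

text \<open>
  The open mapping theorem, with a closed subspace as domain and a merely closed range. By Baire's
  theorem the closure of the image of some ball has interior in the range; this solves \<open>F x = y\<close>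
  up to an error of \<open>norm y / 2\<close>, and summing the successive corrections removes the error.
\<close>

theorem open_mapping_on_closed_subspace:
  fixes F :: "'a::banach \<Rightarrow> 'b::banach"
  assumes F: "bounded_linear F" and D: "subspace D" "closed D" and R: "closed (F ` D)"
  obtains K where "K \<ge> 0" "\<And>x. x \<in> D \<Longrightarrow> \<exists>x'\<in>D. F x' = F x \<and> norm x' \<le> K * norm (F x)"
proof -
  interpret F: bounded_linear F by (rule F)
  let ?R = "F ` D"
  have subR: "subspace ?R" using F.linear D(1) by (rule linear_subspace_image)
  define A where "A k = closure (F ` (D \<inter> cball 0 (real k)))" for k
  have A_sub: "A k \<subseteq> ?R" for k
    unfolding A_def by (rule closure_minimal[OF _ R]) auto
  have A_cover: "?R \<subseteq> \<Union>(range A)"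
  proof
    fix y assume "y \<in> ?R"
    then obtain x where x: "x \<in> D" "y = F x" by auto
    obtain k :: nat where "norm x \<le> real k" using real_arch_simple by blast
    then have "y \<in> A k" unfolding A_def using x closure_subset by fastforce
    then show "y \<in> \<Union>(range A)" by blast
  qed
  obtain k where k: "top_of_set ?R interior_of A k \<noteq> {}"
  proof (rule ccontr)
    assume "\<not> thesis"
    with that have empty: "top_of_set ?R interior_of A k = {}" for k by blast
    have "top_of_set ?R interior_of \<Union>(range A) = {}"
    proof (rule Baire_category_alt)
      have "completely_metrizable_space (top_of_set ?R)"
        using R by (simp add: completely_metrizable_space_closedin completely_metrizable_space_euclidean)
      then show "completely_metrizable_space (top_of_set ?R) \<or>
          locally_compact_space (top_of_set ?R) \<and> regular_space (top_of_set ?R)" ..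
      have "closedin (top_of_set ?R) (A k)" for k
        using A_sub by (rule closed_subset) (simp add: A_def)
      then show "closedin (top_of_set ?R) T \<and> top_of_set ?R interior_of T = {}" if "T \<in> range A" for T
        using that empty by auto
    qed simp
    moreover have "\<Union>(range A) = ?R" using A_sub A_cover by blast
    ultimately have "?R = {}"
      using interior_of_topspace[of "top_of_set ?R"] by simp
    then show False using subspace_0[OF D(1)] by blast
  qed
  obtain y0 r where y0: "y0 \<in> ?R" and r: "r > 0"
    and ball: "\<And>y. y \<in> ?R \<Longrightarrow> dist y0 y < r \<Longrightarrow> y \<in> A k"
  proof -
    from k obtain y0 where "y0 \<in> top_of_set ?R interior_of A k" by blast
    then obtain U where U: "openin (top_of_set ?R) U" "y0 \<in> U" "U \<subseteq> A k"
      by (auto simp: interior_of_def)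
    then obtain V where V: "open V" "U = ?R \<inter> V" by (auto simp: openin_open)
    with U(2) obtain r where "r > 0" "ball y0 r \<subseteq> V" using U(2) by (auto simp: open_contains_ball)
    show ?thesis
    proof (rule that)
      show "y0 \<in> ?R" using U(2) V(2) by blast
      show "y \<in> A k" if "y \<in> ?R" "dist y0 y < r" for y
        using that U(3) V(2) \<open>ball y0 r \<subseteq> V\<close> by (auto simp: subset_iff)
    qed fact
  qed
  \<comment> \<open>A small \<open>y\<close> is the difference of the two points \<open>y0 + y\<close> and \<open>y0\<close> of \<open>A k\<close>.\<close>
  have approx: "\<exists>x\<in>D. norm x \<le> 2 * real k \<and> norm (y - F x) < e"
    if y: "y \<in> ?R" "norm y < r" and e: "e > 0" for y e
  proof -
    have "y0 + y \<in> A k" using y0 y by (intro ball subspace_add[OF subR]) (auto simp: dist_norm)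
    moreover have "y0 \<in> A k" using y0 r by (intro ball) auto
    moreover have "\<exists>a\<in>D. norm a \<le> real k \<and> dist (F a) w < e / 2" if "w \<in> A k" for w
    proof -
      have "\<forall>e>0. \<exists>z\<in>F ` (D \<inter> cball 0 (real k)). dist z w < e"
        using that by (simp add: A_def closure_approachable)
      then show ?thesis using half_gt_zero[OF e] by fastforce
    qed
    ultimately obtain a b where a: "a \<in> D" "norm a \<le> real k" "dist (F a) (y0 + y) < e / 2"
      and b: "b \<in> D" "norm b \<le> real k" "dist (F b) y0 < e / 2"
      by meson
    have "y - F (a - b) = (y0 + y - F a) - (y0 - F b)" by (simp add: F.diff)
    also have "norm \<dots> \<le> norm (y0 + y - F a) + norm (y0 - F b)" by (rule norm_triangle_ineq4)
    also have "\<dots> < e" using a b by (simp add: dist_norm norm_minus_commute)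
    finally have "norm (y - F (a - b)) < e" .
    moreover have "norm (a - b) \<le> 2 * real k" using norm_triangle_ineq4[of a b] a b by simp
    ultimately show ?thesis using subspace_diff[OF D(1) a(1) b(1)] by blast
  qed
  define K where "K = 4 * real k / r"
  have K: "K \<ge> 0" using r by (simp add: K_def)
  have "\<exists>x\<in>D. norm x \<le> K * norm y \<and> norm (y - F x) \<le> norm y / 2" if y: "y \<in> ?R" for y
  proof (cases "y = 0")
    case True
    then show ?thesis using subspace_0[OF D(1)] F.zero by force
  next
    case False
    define c where "c = r / (2 * norm y)"
    have c: "c > 0" using r False by (simp add: c_def)
    have "norm (c *\<^sub>R y) < r" using r False by (simp add: c_def)
    from approx[OF subspace_scale[OF subR y] this, of "c * (norm y / 2)"] c False
    obtain x where x: "x \<in> D" "norm x \<le> 2 * real k" "norm (c *\<^sub>R y - F x) < c * (norm y / 2)"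
      by auto
    have "c *\<^sub>R (y - F ((1 / c) *\<^sub>R x)) = c *\<^sub>R y - F x"
      using c by (simp add: F.scaleR scaleR_diff_right)
    then have "c * norm (y - F ((1 / c) *\<^sub>R x)) < c * (norm y / 2)"
      using x(3) c by (metis norm_scaleR abs_of_pos)
    then have "norm (y - F ((1 / c) *\<^sub>R x)) \<le> norm y / 2" using c by simp
    moreover have "norm ((1 / c) *\<^sub>R x) \<le> K * norm y"
      using c x(2) r False by (simp add: K_def c_def field_simps)
    ultimately show ?thesis using subspace_scale[OF D(1) x(1)] by blast
  qed
  then obtain g where g: "\<And>y. y \<in> ?R \<Longrightarrow> g y \<in> D"
    "\<And>y. y \<in> ?R \<Longrightarrow> norm (g y) \<le> K * norm y"
    "\<And>y. y \<in> ?R \<Longrightarrow> norm (y - F (g y)) \<le> norm y / 2"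
    by metis
  have "\<exists>x'\<in>D. F x' = F x \<and> norm x' \<le> 2 * K * norm (F x)" if x: "x \<in> D" for x
  proof -
    \<comment> \<open>The residuals after \<open>n\<close> corrections.\<close>
    define y where "y n = ((\<lambda>y. y - F (g y)) ^^ n) (F x)" for n
    have y_Suc: "y (Suc n) = y n - F (g (y n))" for n by (simp add: y_def)
    have yR: "y n \<in> ?R" for n
    proof (induction n)
      case (Suc n)
      then show ?case unfolding y_Suc using g(1) by (intro subspace_diff[OF subR]) auto
    qed (use x in \<open>simp add: y_def\<close>)
    have y_le: "norm (y n) \<le> norm (F x) * (1 / 2) ^ n" for n
    proof (induction n)
      case (Suc n)
      then show ?case using g(3)[OF yR[of n]] by (simp add: y_Suc)
    qed (simp add: y_def)
    have gy_le: "norm (g (y n)) \<le> K * norm (F x) * (1 / 2) ^ n" for n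
    proof -
      have "norm (g (y n)) \<le> K * norm (y n)" by (rule g(2)[OF yR])
      also have "\<dots> \<le> K * (norm (F x) * (1 / 2) ^ n)" by (rule mult_left_mono[OF y_le K])
      finally show ?thesis by (simp add: mult.assoc)
    qed
    have geo: "(\<lambda>n. K * norm (F x) * (1 / 2) ^ n) sums (K * norm (F x) * 2)"
      using geometric_sums[of "1 / 2 :: real"] by (intro sums_mult) simp
    have sm: "summable (\<lambda>n. norm (g (y n)))"
      by (rule summable_comparison_test'[OF sums_summable[OF geo]]) (use gy_le in simp)
    define x' where "x' = (\<Sum>n. g (y n))"
    have sums: "(\<lambda>n. g (y n)) sums x'"
      unfolding x'_def using summable_norm_cancel[OF sm] by (rule summable_sums)
    have "(\<Sum>n<m. g (y n)) \<in> D" for m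
      by (rule subspace_sum[OF D(1)]) (rule g(1)[OF yR])
    then have "x' \<in> D"
      by (rule closed_sequentially[OF D(2) _ sums[unfolded sums_def]])
    moreover have "F x' = F x"
    proof -
      have "y \<longlonglongrightarrow> 0"
      proof (rule Lim_null_comparison)
        show "\<forall>\<^sub>F n in sequentially. norm (y n) \<le> norm (F x) * (1 / 2) ^ n"
          using y_le by simp
        show "(\<lambda>n. norm (F x) * (1 / 2) ^ n) \<longlonglongrightarrow> 0"
          by (intro tendsto_mult_right_zero LIMSEQ_power_zero) simp
      qed
      from telescope_sums'[OF this] have "(\<lambda>n. F (g (y n))) sums F x"
        by (simp add: y_Suc) (simp add: y_def)
      moreover have "(\<lambda>n. F (g (y n))) sums F x'" by (rule F.sums[OF sums])
      ultimately show ?thesis by (rule sums_unique2[symmetric])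
    qed
    moreover have "norm x' \<le> 2 * K * norm (F x)"
    proof -
      have "norm x' \<le> (\<Sum>n. norm (g (y n)))" unfolding x'_def by (rule summable_norm[OF sm])
      also have "\<dots> \<le> K * norm (F x) * 2"
        using suminf_le[OF gy_le sm sums_summable[OF geo]] sums_unique[OF geo] by simp
      finally show ?thesis by (simp add: mult_ac)
    qed
    ultimately show ?thesis by blast
  qed
  with K show ?thesis by (intro that[of "2 * K"]) simp_all
qed

text \<open>
  A functional that vanishes on \<open>Y\<close> but not at \<open>v\<close> exhibits the sum as the preimage of \<open>Y\<close> under a
  continuous projection along \<open>v\<close>.
\<close>

lemma closed_subspace_plus_line:
  fixes Y :: "'a::real_normed_vector set"
  assumes Y: "subspace Y" "closed Y"
  shows "closed (Y + span {v})"
proof (cases "v \<in> Y")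
  case True
  have "Y + span {v} = Y"
  proof
    show "Y + span {v} \<subseteq> Y"
      using subspace_add[OF Y(1)] subspace_scale[OF Y(1) True]
      by (auto simp: set_plus_def span_singleton)
    show "Y \<subseteq> Y + span {v}"
      using set_plus_intro[OF _ span_zero, of _ Y "{v}"] by auto
  qed
  then show ?thesis using Y(2) by simp
next
  case False
  obtain u :: "'a \<Rightarrow> real" where u: "bounded_linear u" "\<And>y. y \<in> Y \<Longrightarrow> u y = 0" "u v \<noteq> 0"
    using functional_separating_point_from_closed_subspace[OF Y False] by metis
  interpret u: bounded_linear u by (rule u(1))
  have "Y + span {v} = (\<lambda>z. z - (u z / u v) *\<^sub>R v) -` Y"
  proof (intro equalityI subsetI)
    fix z assume "z \<in> Y + span {v}"
    then obtain y t where y: "y \<in> Y" and z: "z = y + t *\<^sub>R v"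
      by (auto simp: set_plus_def span_singleton)
    then have "u z / u v = t" using u by (simp add: u.add u.scaleR)
    with y z show "z \<in> (\<lambda>z. z - (u z / u v) *\<^sub>R v) -` Y" by simp
  next
    fix z assume "z \<in> (\<lambda>z. z - (u z / u v) *\<^sub>R v) -` Y"
    then have "(z - (u z / u v) *\<^sub>R v) + (u z / u v) *\<^sub>R v \<in> Y + span {v}"
      by (intro set_plus_intro) (auto simp: span_singleton)
    then show "z \<in> Y + span {v}" by simp
  qed
  moreover have "continuous_on UNIV (\<lambda>z. z - (u z / u v) *\<^sub>R v)"
    using u(3) by (intro continuous_intros u.continuous_on) auto
  ultimately show ?thesis using closed_vimage[OF Y(2)] by simp
qed

lemma span_Un_plus: "span (A \<union> B) = span A + span B"
  by (auto simp: span_Un set_plus_def)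

lemma closed_subspace_plus_finite_span:
  fixes Y :: "'a::real_normed_vector set"
  assumes "finite B" and Y: "subspace Y" "closed Y"
  shows "closed (Y + span B)"
  using \<open>finite B\<close>
proof (induction B)
  case empty
  have "Y + span {} = Y" by (auto simp: set_plus_def)
  then show ?case using Y by simp
next
  case (insert b B)
  have sub: "subspace (Y + span B)"
    using subspace_sums[OF Y(1) subspace_span[of B]]
    by (rule back_subst[of subspace]) (auto simp: set_plus_def)
  have "span (insert b B) = span B + span {b}"
    using span_Un_plus[of B "{b}"] by simp
  then have "Y + span (insert b B) = (Y + span B) + span {b}"
    by (simp add: add.assoc)
  then show ?case using closed_subspace_plus_line[OF sub insert.IH] by simp
qed

lemma closed_finite_span:
  fixes B :: "'a::real_normed_vector set"
  assumes "finite B"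
  shows "closed (span B)"
proof -
  have "{0} + span B = span B" by (auto simp: set_plus_def)
  with closed_subspace_plus_finite_span[OF assms, of "{0}"] show ?thesis by simp
qed

lemma subspace_within_finite_span:
  fixes A :: "'a::real_vector set"
  assumes A: "subspace A" and B: "finite B" "A \<subseteq> span B"
  obtains C where "finite C" "C \<subseteq> A" "span C = A"
proof -
  obtain C where C: "C \<subseteq> A" "independent C" "A \<subseteq> span C"
    using maximal_independent_subset[of A] by blast
  have "finite C" using independent_span_bound[OF B(1) C(2)] C(1) B(2) by blast
  moreover have "span C = A" using C A span_minimal by blast
  ultimately show ?thesis using C(1) that by blast
qed

text \<open>
  The inequality between the dimension of a subspace and those of its image and of the kernel, in a
  form that speaks only of finite spanning sets.
\<close>

lemma finite_span_of_image_and_kernel: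
  fixes f :: "'a::real_vector \<Rightarrow> 'b::real_vector"
  assumes f: "linear f" and B: "finite B" "f ` A \<subseteq> span B"
    and K: "finite K" "{x. f x = 0} \<subseteq> span K"
  obtains C where "finite C" "A \<subseteq> span C"
proof -
  have "subspace (f ` span A)" using f subspace_span by (rule linear_subspace_image)
  moreover have "f ` span A \<subseteq> span B"
    using linear_span_image[OF f, of A] span_minimal[OF B(2) subspace_span] by simp
  ultimately obtain C0 where C0: "finite C0" "C0 \<subseteq> f ` span A" "span C0 = f ` span A"
    using subspace_within_finite_span[OF _ B(1)] by metis
  then obtain C1 where C1: "finite C1" "C0 = f ` C1" by (meson finite_subset_image)
  have "A \<subseteq> span (C1 \<union> K)"
  proof
    fix x assume "x \<in> A"
    then have "f x \<in> f ` span C1"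
      using C0(3) C1(2) linear_span_image[OF f, of C1] span_base by blast
    then obtain c where c: "c \<in> span C1" "f x = f c" by blast
    then have "x - c \<in> span K" using K(2) by (auto simp: linear_diff[OF f])
    with c(1) have "c + (x - c) \<in> span (C1 \<union> K)" unfolding span_Un_plus by (rule set_plus_intro)
    then show "x \<in> span (C1 \<union> K)" by simp
  qed
  then show ?thesis using that C1(1) K(1) by blast
qed

section \<open>Lower bounds for tuples modulo a finite-dimensional subspace\<close>

lemma norm_vec_le_sum: "norm (z :: 'a::real_normed_vector ^ 'n) \<le> (\<Sum>i\<in>UNIV. norm (z $ i))"
  unfolding norm_vec_def by (rule L2_set_le_sum) simp

lemma bounded_linear_axis: "bounded_linear (axis i :: 'a::real_normed_vector \<Rightarrow> 'a ^ 'n)"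
proof (rule bounded_linear_intro[where K = 1])
  show "norm (axis i x :: 'a ^ 'n) \<le> norm x * 1" for x
    using norm_vec_le_sum[of "axis i x"] by (simp add: axis_def if_distrib[of norm] cong: if_cong)
qed (auto simp: vec_eq_iff axis_def)

lemma sum_axis_nth: "(\<Sum>i\<in>UNIV. axis i (z i)) = (\<chi> i. z i)"
  for z :: "'n::finite \<Rightarrow> 'a::comm_monoid_add"
  by (simp add: vec_eq_iff axis_def)

lemma vectors_over_finite_span:
  fixes B :: "'a::real_vector set"
  assumes "finite B"
  obtains B' :: "('a ^ 'n) set" where "finite B'" "span B' = {z. \<forall>i. z $ i \<in> span B}"
proof -
  let ?B = "\<Union>i. axis i ` B :: ('a ^ 'n) set"
  have lin: "linear (axis i :: 'a \<Rightarrow> 'a ^ 'n)" for i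
    by (auto simp: linear_iff vec_eq_iff axis_def)
  have "span ?B = {z. \<forall>i. z $ i \<in> span B}"
  proof (intro equalityI)
    show "span ?B \<subseteq> {z. \<forall>i. z $ i \<in> span B}"
    proof (rule span_minimal)
      show "?B \<subseteq> {z. \<forall>i. z $ i \<in> span B}"
        by (auto simp: axis_def span_zero span_base)
      show "subspace {z :: 'a ^ 'n. \<forall>i. z $ i \<in> span B}"
        by (auto simp: subspace_def span_zero span_add span_scale)
    qed
    show "{z. \<forall>i. z $ i \<in> span B} \<subseteq> span ?B"
    proof clarify
      fix z :: "'a ^ 'n" assume z: "\<forall>i. z $ i \<in> span B"
      have "axis i (z $ i) \<in> span ?B" for i
      proof -
        have "axis i (z $ i) \<in> span (axis i ` B)"
          using z by (simp add: linear_span_image[OF lin])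
        then show ?thesis using span_mono[of "axis i ` B" ?B] by blast
      qed
      then have "(\<Sum>i\<in>UNIV. axis i (z $ i)) \<in> span ?B" by (intro span_sum)
      then show "z \<in> span ?B" by (simp add: sum_axis_nth)
    qed
  qed
  then show ?thesis using assms by (intro that[of ?B]) auto
qed

text \<open>
  On the quotient by \<open>span B\<close> the tuple is injective with closed range, hence bounded below. The
  quotient is avoided by applying the open mapping theorem to \<open>(x, z) \<mapsto> (W i x)\<^sub>i + z\<close>, where \<open>z\<close>
  runs over vectors with entries in \<open>span B\<close>: if \<open>x'\<close> is a small first component of a preimage of
  the value at \<open>x\<close>, then \<open>x - x'\<close> lies in \<open>span B\<close>.
\<close>

lemma tuple_bounded_below_modulo_finite_span:
  fixes W :: "'n::finite \<Rightarrow> 'a::banach \<Rightarrow> 'a"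
  assumes W: "\<And>i. bounded_linear (W i)" and closed: "closed (range (\<lambda>x. \<chi> i. W i x))"
    and B: "finite B" and inj: "\<And>x. (\<And>i. W i x \<in> span B) \<Longrightarrow> x \<in> span B"
  obtains C where "C \<ge> 0"
    "\<And>x y. (\<And>i. y i \<in> span B) \<Longrightarrow> \<exists>v\<in>span B. norm (x - v) \<le> C * (\<Sum>i\<in>UNIV. norm (W i x - y i))"
proof -
  let ?d = "\<lambda>x. \<chi> i. W i x"
  obtain B' :: "('a ^ 'n) set" where B': "finite B'" and M: "span B' = {z. \<forall>i. z $ i \<in> span B}"
    using vectors_over_finite_span[OF B] .
  have d: "bounded_linear ?d"
  proof -
    have "bounded_linear (\<lambda>x. \<Sum>i\<in>UNIV. axis i (W i x))"
      by (intro bounded_linear_sum bounded_linear_compose[OF bounded_linear_axis W])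
    then show ?thesis by (simp add: sum_axis_nth)
  qed
  define F where "F = (\<lambda>(x, z). ?d x + z)"
  define D where "D = (UNIV :: 'a set) \<times> span B'"
  have F: "bounded_linear F"
    unfolding F_def split_beta'
    by (intro bounded_linear_add bounded_linear_compose[OF d] bounded_linear_fst bounded_linear_snd)
  have sub: "subspace D" unfolding D_def by (intro subspace_Times subspace_UNIV subspace_span)
  have cl: "closed D" unfolding D_def by (intro closed_Times closed_UNIV closed_finite_span B')
  have "F ` D = range ?d + span B'"
    by (force simp: F_def D_def set_plus_def image_iff)
  moreover have "subspace (range ?d)"
    using bounded_linear.linear[OF d] subspace_UNIV by (rule linear_subspace_image)
  ultimately have "closed (F ` D)"
    using closed_subspace_plus_finite_span[OF B' _ closed] by simp
  from open_mapping_on_closed_subspace[OF F sub cl this]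
  obtain C where C: "C \<ge> 0"
    and F_C: "\<And>q. q \<in> D \<Longrightarrow> \<exists>q'\<in>D. F q' = F q \<and> norm q' \<le> C * norm (F q)" by metis
  have "\<exists>v\<in>span B. norm (x - v) \<le> C * (\<Sum>i\<in>UNIV. norm (W i x - y i))"
    if y: "\<And>i. y i \<in> span B" for x y
  proof -
    have "(x, \<chi> i. - y i) \<in> D" using y by (simp add: D_def M span_neg)
    from F_C[OF this] obtain x' z where z: "z \<in> span B'" and eq: "F (x', z) = F (x, \<chi> i. - y i)"
      and le: "norm (x', z) \<le> C * norm (F (x, \<chi> i. - y i))"
      by (auto simp: D_def)
    have "x - x' \<in> span B"
    proof (rule inj)
      fix i
      have "W i x' + z $ i = W i x - y i"
        using eq by (simp add: F_def vec_eq_iff)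
      then have "W i (x - x') = z $ i + y i"
        by (simp add: bounded_linear.linear[OF W] linear_diff algebra_simps)
      then show "W i (x - x') \<in> span B" using z y M by (simp add: span_add)
    qed
    moreover have "norm x' \<le> C * (\<Sum>i\<in>UNIV. norm (W i x - y i))"
    proof -
      have "norm x' \<le> norm (x', z)" by (rule norm_fst_le)
      also note le
      also have "norm (F (x, \<chi> i. - y i)) \<le> (\<Sum>i\<in>UNIV. norm (W i x - y i))"
        using norm_vec_le_sum[of "F (x, \<chi> i. - y i)"] by (simp add: F_def)
      finally show ?thesis using C by (simp add: mult_left_mono)
    qed
    ultimately show ?thesis by (intro bexI[of _ "x - x'"]) auto
  qed
  with C show ?thesis by (rule that)
qed

text \<open>
  Iterating the previous bound would require monomials of high degree, each containing a \<open>k\<close>-th power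
  of some \<open>W i\<close>. That bookkeeping is delegated to \<open>commuting_Nakayama\<close>, applied to the set of maps \<open>g\<close>
  such that the distance from \<open>g x\<close> to \<open>span B\<close> is at most a multiple of the right-hand side: the
  power \<open>W i ^^ k\<close> trivially belongs to it, and the conclusion concerns the identity.
\<close>

lemma tuple_powers_bounded_below_modulo_finite_span:
  fixes W :: "'n::finite \<Rightarrow> 'a::banach \<Rightarrow> 'a"
  assumes W: "\<And>i. bounded_linear (W i)" and comm: "\<And>i j x. W i (W j x) = W j (W i x)"
    and closed: "closed (range (\<lambda>x. \<chi> i. W i x))" and B: "finite B"
    and inv: "\<And>i x. x \<in> span B \<Longrightarrow> W i x \<in> span B"
    and inj: "\<And>x. (\<And>i. W i x \<in> span B) \<Longrightarrow> x \<in> span B"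
  obtains C where "C \<ge> 0"
    "\<And>x. \<exists>v\<in>span B. norm (x - v) \<le> C * (\<Sum>i\<in>UNIV. norm ((W i ^^ k) x))"
proof -
  from tuple_bounded_below_modulo_finite_span[OF W closed B inj]
  obtain K where K: "K \<ge> 0" and low: "\<And>x y. (\<And>i. y i \<in> span B) \<Longrightarrow>
      \<exists>v\<in>span B. norm (x - v) \<le> K * (\<Sum>i\<in>UNIV. norm (W i x - y i))" by metis
  define s where "s x = (\<Sum>i\<in>UNIV. norm ((W i ^^ k) x))" for x
  have s: "s x \<ge> 0" for x by (simp add: s_def sum_nonneg)
  define Z where "Z = {g. \<exists>C\<ge>0. \<forall>x. \<exists>v\<in>span B. norm (g x - v) \<le> C * s x}"
  have "id \<in> Z"
  proof (rule commuting_Nakayama[where W = "\<lambda>i g. W i \<circ> g" and k = "\<lambda>_. k"])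
    show "W i \<circ> (W j \<circ> g) = W j \<circ> (W i \<circ> g)" for i j and g :: "'a \<Rightarrow> 'a"
      using comm by (simp add: fun_eq_iff)
  next
    fix i g assume "g \<in> Z"
    then obtain C where C: "C \<ge> 0" "\<And>x. \<exists>v\<in>span B. norm (g x - v) \<le> C * s x"
      by (auto simp: Z_def)
    interpret bounded_linear "W i" by (rule W)
    obtain L where L: "L \<ge> 0" "\<And>x. norm (W i x) \<le> norm x * L" using nonneg_bounded by blast
    have "\<exists>v\<in>span B. norm ((W i \<circ> g) x - v) \<le> (C * L) * s x" for x
    proof -
      obtain v where v: "v \<in> span B" "norm (g x - v) \<le> C * s x" using C(2) by blast
      have "norm (W i (g x) - W i v) \<le> norm (g x - v) * L" using L(2)[of "g x - v"] by (simp add: diff)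
      also have "\<dots> \<le> C * s x * L" using v(2) L(1) by (rule mult_right_mono)
      finally show ?thesis using inv[OF v(1)] by (auto simp: mult_ac)
    qed
    then show "W i \<circ> g \<in> Z" using C(1) L(1) unfolding Z_def by (auto intro: exI[of _ "C * L"])
  next
    fix g assume "\<And>i. W i \<circ> g \<in> Z"
    then have "\<exists>C\<ge>0. \<forall>x. \<exists>v\<in>span B. norm (W i (g x) - v) \<le> C * s x" for i
      by (simp add: Z_def)
    then obtain C where C: "\<And>i. C i \<ge> 0" "\<And>i x. \<exists>v\<in>span B. norm (W i (g x) - v) \<le> C i * s x"
      by metis
    have "\<exists>v\<in>span B. norm (g x - v) \<le> (K * sum C UNIV) * s x" for x
    proof -
      obtain y where y: "\<And>i. y i \<in> span B" "\<And>i. norm (W i (g x) - y i) \<le> C i * s x"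
      proof -
        have "\<forall>i. \<exists>v. v \<in> span B \<and> norm (W i (g x) - v) \<le> C i * s x" using C(2) by blast
        then show ?thesis using that by (metis (no_types))
      qed
      from low[of y "g x"] y(1) obtain v where v: "v \<in> span B"
        "norm (g x - v) \<le> K * (\<Sum>i\<in>UNIV. norm (W i (g x) - y i))" by blast
      note v(2)
      also have "K * (\<Sum>i\<in>UNIV. norm (W i (g x) - y i)) \<le> K * (\<Sum>i\<in>UNIV. C i * s x)"
        by (intro mult_left_mono sum_mono y K)
      finally show ?thesis using v(1) by (auto simp: sum_distrib_right mult.assoc)
    qed
    then show "g \<in> Z" using K C(1) unfolding Z_def
      by (auto intro!: exI[of _ "K * sum C UNIV"] mult_nonneg_nonneg sum_nonneg)
  next
    fix i
    have "((\<lambda>g. W i \<circ> g) ^^ m) id = W i ^^ m" for m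
      by (induction m) simp_all
    moreover have "norm ((W i ^^ k) x - 0) \<le> 1 * s x" for x
      by (auto simp: s_def intro: member_le_sum)
    ultimately show "((\<lambda>g. W i \<circ> g) ^^ k) id \<in> Z"
      unfolding Z_def using span_zero by (auto intro!: exI[of _ "1 :: real"] bexI[of _ 0])
  qed
  then obtain C where "C \<ge> 0" "\<And>x. \<exists>v\<in>span B. norm (x - v) \<le> C * s x"
    by (auto simp: Z_def)
  then show ?thesis unfolding s_def by (rule that)
qed

section \<open>Complex functionals\<close>

lemma scaleC_eq_Re_Im: "c *\<^sub>C x = Re c *\<^sub>R x + Im c *\<^sub>R (\<i> *\<^sub>C x)"
proof -
  have "c *\<^sub>C x = (of_real (Re c) + of_real (Im c) * \<i>) *\<^sub>C x"
    by (simp add: complex_eq mult.commute)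
  then show ?thesis by (simp only: scaleC_add_left scaleC_of_real scaleC_scaleC[symmetric])
qed

lemma i_i_scaleC: "\<i> *\<^sub>C \<i> *\<^sub>C x = - x"
  using complex_vector.scale_minus_left[of 1 x] by (simp add: scaleC_scaleC scaleC_one)

lemma csubspace_imp_subspace: "csubspace V \<Longrightarrow> subspace V"
  unfolding subspace_def complex_vector.subspace_def by (metis scaleC_of_real)

lemma bounded_linear_cblinfun_apply: "bounded_linear (cblinfun_apply A)"
  using cblinfun_apply[of A] by (simp add: bounded_clinear_def)

lemma cblinfun_apply_scaleC: "cblinfun_apply A (c *\<^sub>C x) = c *\<^sub>C cblinfun_apply A x"
  using cblinfun_apply[of A] by (simp add: bounded_clinear_def)

lemmas linear_cblinfun_apply = bounded_linear.linear[OF bounded_linear_cblinfun_apply]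

lemma cblinfun_apply_sum: "cblinfun_apply (sum f I) x = (\<Sum>i\<in>I. cblinfun_apply (f i) x)"
  by (induction I rule: infinite_finite_induct)
    (simp_all add: zero_cblinfun.rep_eq plus_cblinfun.rep_eq)

lemma op_pow_apply: "cblinfun_apply (op_pow A k) = cblinfun_apply A ^^ k"
  by (induction k) (simp_all add: fun_eq_iff cblinfun_id.rep_eq cblinfun_compose.rep_eq)

lemma op_pow_dual_apply:
  "cblinfun_apply (op_pow (dual_op A) k) g = g o\<^sub>C\<^sub>L op_pow A k"
proof (rule cblinfun_apply_inject[THEN iffD1], rule ext)
  show "cblinfun_apply (cblinfun_apply (op_pow (dual_op A) k) g) x
      = cblinfun_apply (g o\<^sub>C\<^sub>L op_pow A k) x" for x
  proof (induction k arbitrary: x)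
    case (Suc k)
    then show ?case
      by (simp add: op_pow_apply[of A] dual_op_apply cblinfun_compose.rep_eq funpow_swap1)
  qed (simp add: cblinfun_id.rep_eq cblinfun_compose.rep_eq)
qed

text \<open>
  Bohnenblust-Sobczyk: \<open>u\<close> becomes the real part of a complex functional.
\<close>

lemma complex_functional_of_real_functional:
  fixes u :: "'a::complex_normed_vector \<Rightarrow> real"
  assumes "bounded_linear u"
  obtains g :: "'a cdual"
    where "\<And>z. cblinfun_apply g z = complex_of_real (u z) - \<i> * complex_of_real (u (\<i> *\<^sub>C z))"
proof -
  interpret u: bounded_linear u by (rule assms)
  let ?g = "\<lambda>z. complex_of_real (u z) - \<i> * complex_of_real (u (\<i> *\<^sub>C z))"
  have "bounded_clinear ?g"
  proof (rule bounded_clinearI)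
    have "bounded_linear (\<lambda>z. u (\<i> *\<^sub>C z))"
      by (rule bounded_linear_compose[OF assms bounded_linear_scaleC])
    then show "bounded_linear ?g"
      by (intro bounded_linear_sub bounded_linear_compose[OF bounded_linear_of_real assms]
          bounded_linear_compose[OF bounded_linear_mult_right]
          bounded_linear_compose[OF bounded_linear_of_real])
  next
    fix c and z :: 'a
    have expand: "u (c *\<^sub>C w) = Re c * u w + Im c * u (\<i> *\<^sub>C w)" for w
    proof -
      show ?thesis by (simp add: scaleC_eq_Re_Im[of c w] u.add u.scaleR)
    qed
    note i_i_scaleC[of z]
    moreover have "\<i> *\<^sub>C c *\<^sub>C z = c *\<^sub>C \<i> *\<^sub>C z"
      by (simp add: scaleC_scaleC mult.commute)
    ultimately have "u (\<i> *\<^sub>C c *\<^sub>C z) = Re c * u (\<i> *\<^sub>C z) - Im c * u z"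
      by (simp only: expand u.neg)
    then show "?g (c *\<^sub>C z) = c *\<^sub>C ?g z"
      by (simp add: expand[of z] scaleC_complex_def complex_eq_iff)
  qed
  then show ?thesis
    by (intro that[of "CBlinfun ?g"]) (simp add: CBlinfun_inverse)
qed

lemma complex_functional_separating_point_from_closed_subspace:
  fixes N :: "'a::complex_normed_vector set"
  assumes N: "csubspace N" "closed N" and x: "x \<notin> N"
  shows "\<exists>f :: 'a cdual. (\<forall>v\<in>N. cblinfun_apply f v = 0) \<and> cblinfun_apply f x \<noteq> 0"
proof -
  have scale: "c *\<^sub>C v \<in> N" if "v \<in> N" for c v
    using that N(1) by (rule complex_vector.subspace_scale[rotated])
  from functional_separating_point_from_closed_subspace[OF csubspace_imp_subspace[OF N(1)] N(2) x]
  obtain u :: "'a \<Rightarrow> real" where u: "bounded_linear u" and u0: "\<And>v. v \<in> N \<Longrightarrow> u v = 0"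
    and ux: "u x \<noteq> 0" by metis
  obtain g :: "'a cdual"
    where g: "\<And>z. cblinfun_apply g z = complex_of_real (u z) - \<i> * complex_of_real (u (\<i> *\<^sub>C z))"
    using complex_functional_of_real_functional[OF u] by metis
  show ?thesis
  proof (intro exI[of _ g] conjI ballI)
    show "cblinfun_apply g v = 0" if "v \<in> N" for v
      using u0 scale that by (simp add: g)
    show "cblinfun_apply g x \<noteq> 0" using ux by (simp add: g complex_eq_iff)
  qed
qed

text \<open>
  The real part of \<open>f\<close> factors through \<open>x \<mapsto> (W i x)\<^sub>i\<close>; its components along the coordinate axes
  are then made complex one by one, which avoids a complex structure on the product space.
\<close>

lemma complex_functional_factors_through_tuple:
  fixes W :: "'n::finite \<Rightarrow> 'a::complex_normed_vector \<Rightarrow>\<^sub>C\<^sub>L 'a" and f :: "'a cdual"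
  assumes "0 \<le> K" and le: "\<And>x. norm (cblinfun_apply f x) \<le> K * (\<Sum>i\<in>UNIV. norm (cblinfun_apply (W i) x))"
  obtains g :: "'n \<Rightarrow> 'a cdual" where "f = (\<Sum>i\<in>UNIV. g i o\<^sub>C\<^sub>L W i)"
proof -
  let ?L = "\<lambda>x. \<chi> i. cblinfun_apply (W i) x"
  let ?h = "\<lambda>x. Re (cblinfun_apply f x)"
  have L: "linear ?L"
    by (auto simp: linear_iff vec_eq_iff linear_add[OF linear_cblinfun_apply] linear_scale[OF linear_cblinfun_apply])
  have h: "linear ?h"
    by (auto simp: linear_iff linear_add[OF linear_cblinfun_apply] linear_scale[OF linear_cblinfun_apply])
  have "?h x \<le> (K * real CARD('n)) * norm (?L x)" for x
  proof -
    have "?h x \<le> norm (cblinfun_apply f x)" by (rule complex_Re_le_cmod)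
    also have "\<dots> \<le> K * (\<Sum>i\<in>UNIV. norm (cblinfun_apply (W i) x))" by (rule le)
    also have "\<dots> \<le> K * (\<Sum>i\<in>(UNIV :: 'n set). norm (?L x))"
    proof (intro mult_left_mono sum_mono \<open>0 \<le> K\<close>)
      show "norm (cblinfun_apply (W i) x) \<le> norm (?L x)" for i
        using Finite_Cartesian_Product.norm_nth_le[of "?L x" i] by simp
    qed
    finally show ?thesis by (simp add: mult.assoc)
  qed
  then obtain u where u: "bounded_linear u" and uL: "\<And>x. u (?L x) = ?h x"
    using functional_factors_through[OF L h, of "K * real CARD('n)"] \<open>0 \<le> K\<close> by auto
  have ax: "bounded_linear (\<lambda>z. u (axis i z))" for i :: 'n
    by (rule bounded_linear_compose[OF u bounded_linear_axis])
  have "\<exists>g :: 'a cdual. \<forall>z. cblinfun_apply g z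
      = complex_of_real (u (axis i z)) - \<i> * complex_of_real (u (axis i (\<i> *\<^sub>C z)))" for i
    using complex_functional_of_real_functional[OF ax[of i]] by metis
  then obtain g :: "'n \<Rightarrow> 'a cdual" where g: "\<And>i z. cblinfun_apply (g i) z
      = complex_of_real (u (axis i z)) - \<i> * complex_of_real (u (axis i (\<i> *\<^sub>C z)))"
    by metis
  have sum_ax: "(\<Sum>i\<in>UNIV. u (axis i (cblinfun_apply (W i) x))) = ?h x" for x
  proof -
    have "(\<Sum>i\<in>UNIV. u (axis i (cblinfun_apply (W i) x)))
        = u (\<Sum>i\<in>UNIV. axis i (cblinfun_apply (W i) x))"
      by (simp add: linear_sum[OF bounded_linear.linear[OF u]])
    then show ?thesis using uL by (simp add: sum_axis_nth)
  qed
  have "cblinfun_apply f x = cblinfun_apply (\<Sum>i\<in>UNIV. g i o\<^sub>C\<^sub>L W i) x" for x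
  proof -
    have "cblinfun_apply (\<Sum>i\<in>UNIV. g i o\<^sub>C\<^sub>L W i) x
        = complex_of_real (\<Sum>i\<in>UNIV. u (axis i (cblinfun_apply (W i) x)))
          - \<i> * complex_of_real (\<Sum>i\<in>UNIV. u (axis i (cblinfun_apply (W i) (\<i> *\<^sub>C x))))"
      by (simp add: cblinfun_apply_sum cblinfun_compose.rep_eq g sum_subtractf sum_distrib_left
          cblinfun_apply_scaleC)
    also have "\<dots> = complex_of_real (?h x) - \<i> * complex_of_real (?h (\<i> *\<^sub>C x))"
      by (simp only: sum_ax)
    also have "\<dots> = cblinfun_apply f x"
      by (simp add: cblinfun_apply_scaleC scaleC_complex_def complex_eq_iff)
    finally show ?thesis by simp
  qed
  then have "f = (\<Sum>i\<in>UNIV. g i o\<^sub>C\<^sub>L W i)"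
    by (intro cblinfun_apply_inject[THEN iffD1] ext)
  then show ?thesis by (rule that)
qed

section \<open>Kernels of powers and finite ascent\<close>

lemma commuting_tuples_apply:
  "W \<in> commuting_tuples \<Longrightarrow>
    cblinfun_apply (W $ i) (cblinfun_apply (W $ j) x) = cblinfun_apply (W $ j) (cblinfun_apply (W $ i) x)"
  unfolding commuting_tuples_def by (metis (mono_tags, lifting) cblinfun_compose.rep_eq mem_Collect_eq)

lemma mem_tuple_ker_pow: "x \<in> tuple_ker (tuple_pow W k) \<longleftrightarrow> (\<forall>i. (cblinfun_apply (W $ i) ^^ k) x = 0)"
  by (simp add: tuple_ker_def tuple_pow_def op_ker_def op_pow_apply)

lemma csubspace_op_ker: "csubspace (op_ker A)"
  by (auto simp: op_ker_def complex_vector.subspace_def linear_0[OF linear_cblinfun_apply]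
      linear_add[OF linear_cblinfun_apply] cblinfun_apply_scaleC)

lemma csubspace_tuple_ker: "csubspace (tuple_ker W)"
  unfolding tuple_ker_def by (auto intro: complex_vector.subspace_Inter csubspace_op_ker)

lemma tuple_ker_pow_mono: "k \<le> m \<Longrightarrow> tuple_ker (tuple_pow W k) \<subseteq> tuple_ker (tuple_pow W m)"
proof
  fix x assume "k \<le> m" and x: "x \<in> tuple_ker (tuple_pow W k)"
  then have "(cblinfun_apply (W $ i) ^^ ((m - k) + k)) x = 0" for i
    by (simp only: funpow_add) (simp add: mem_tuple_ker_pow linear_0[OF linear_cblinfun_apply]
        flip: op_pow_apply)
  then show "x \<in> tuple_ker (tuple_pow W m)" using \<open>k \<le> m\<close> by (simp add: mem_tuple_ker_pow)
qed

lemma tuple_ker_pow_invariant: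
  assumes comm: "\<And>j x. cblinfun_apply A (cblinfun_apply (W $ j) x) = cblinfun_apply (W $ j) (cblinfun_apply A x)"
    and x: "x \<in> tuple_ker (tuple_pow W k)"
  shows "cblinfun_apply A x \<in> tuple_ker (tuple_pow W k)"
proof -
  have "(cblinfun_apply (W $ j) ^^ k) (cblinfun_apply A x) = cblinfun_apply A ((cblinfun_apply (W $ j) ^^ k) x)"
    for j by (rule funpow_commuting) (rule comm[symmetric])
  then show ?thesis using x by (simp add: mem_tuple_ker_pow linear_0[OF linear_cblinfun_apply])
qed

text \<open>
  Together with invariance this says that no nonzero vector of the quotient by the stable kernel is
  annihilated by the whole tuple.
\<close>

lemma tuple_ker_pow_reflects:
  assumes W: "W \<in> commuting_tuples"
    and stable: "tuple_ker (tuple_pow W p) = tuple_ker (tuple_pow W (p + 1))"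
    and x: "\<And>i. cblinfun_apply (W $ i) x \<in> tuple_ker (tuple_pow W p)"
  shows "x \<in> tuple_ker (tuple_pow W p)"
proof -
  have "(cblinfun_apply (W $ i) ^^ (p + 1)) x = 0" for i
    using x[of i] by (simp add: mem_tuple_ker_pow funpow_swap1)
  then show ?thesis unfolding stable mem_tuple_ker_pow by simp
qed

lemma ascent_finite_iff:
  "ascent W < \<infinity> \<longleftrightarrow> (\<exists>k. tuple_ker (tuple_pow W k) = tuple_ker (tuple_pow W (k + 1)))"
  by (simp add: ascent_def)

lemma subspace_tuple_ker_inf: "subspace (tuple_ker_inf W)"
proof (rule subspaceI)
  note sub = csubspace_imp_subspace[OF csubspace_tuple_ker]
  show "0 \<in> tuple_ker_inf W" using subspace_0[OF sub] by (auto simp: tuple_ker_inf_def)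
  show "c *\<^sub>R x \<in> tuple_ker_inf W" if "x \<in> tuple_ker_inf W" for c x
    using that subspace_scale[OF sub] by (auto simp: tuple_ker_inf_def)
  fix x y assume "x \<in> tuple_ker_inf W" "y \<in> tuple_ker_inf W"
  then obtain k m where "x \<in> tuple_ker (tuple_pow W k)" "y \<in> tuple_ker (tuple_pow W m)"
    by (auto simp: tuple_ker_inf_def)
  then have "x \<in> tuple_ker (tuple_pow W (max k m))" "y \<in> tuple_ker (tuple_pow W (max k m))"
    using tuple_ker_pow_mono[of k "max k m" W] tuple_ker_pow_mono[of m "max k m" W] by auto
  then show "x + y \<in> tuple_ker_inf W"
    using subspace_add[OF sub] by (auto simp: tuple_ker_inf_def)
qed

text \<open>
  A finite spanning set of the union of the kernels already lies in one of them.
\<close>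

lemma ascent_finite_if_tuple_ker_inf_finite_dim:
  assumes B: "finite B" "tuple_ker_inf W \<subseteq> span B"
  shows "ascent W < \<infinity>"
proof -
  obtain C where C: "finite C" "C \<subseteq> tuple_ker_inf W" "span C = tuple_ker_inf W"
    using subspace_within_finite_span[OF subspace_tuple_ker_inf B] by metis
  from C(2) have "\<forall>c\<in>C. \<exists>k. c \<in> tuple_ker (tuple_pow W k)"
    by (auto simp: tuple_ker_inf_def)
  then obtain k where k: "\<And>c. c \<in> C \<Longrightarrow> c \<in> tuple_ker (tuple_pow W (k c))" by metis
  obtain m where m: "\<And>c. c \<in> C \<Longrightarrow> k c \<le> m"
    using finite_nat_set_iff_bounded_le[of "k ` C"] C(1) by auto
  have "C \<subseteq> tuple_ker (tuple_pow W m)"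
    using k tuple_ker_pow_mono[OF m] by blast
  then have "tuple_ker_inf W \<subseteq> tuple_ker (tuple_pow W m)"
    unfolding C(3)[symmetric]
    by (rule span_minimal[OF _ csubspace_imp_subspace[OF csubspace_tuple_ker]])
  then have "tuple_ker (tuple_pow W m) = tuple_ker (tuple_pow W (m + 1))"
    using tuple_ker_pow_mono[of m "m + 1" W] by (auto simp: tuple_ker_inf_def)
  then show ?thesis unfolding ascent_finite_iff ..
qed

lemma cfinite_dim_imp_finite_span:
  fixes V :: "'a::complex_vector set"
  assumes "cfinite_dim V"
  obtains B where "finite B" "V \<subseteq> span B"
proof -
  obtain B where B: "finite B" "V = cspan B" using assms by (auto simp: cfinite_dim_def)
  let ?B = "B \<union> (\<lambda>b. \<i> *\<^sub>C b) ` B"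
  have i: "\<i> *\<^sub>C x \<in> span ?B" if "x \<in> span ?B" for x
  proof -
    have "linear (\<lambda>x :: 'a. \<i> *\<^sub>C x)"
      by (simp add: linear_iff scaleC_add_right scaleC_scaleR_commute)
    then have "(\<lambda>x. \<i> *\<^sub>C x) ` span ?B = span ((\<lambda>x. \<i> *\<^sub>C x) ` ?B)"
      by (simp add: linear_span_image)
    also have "\<dots> \<subseteq> span ?B"
    proof (rule span_minimal)
      show "(\<lambda>x. \<i> *\<^sub>C x) ` ?B \<subseteq> span ?B"
        using i_i_scaleC by (auto simp: image_Un image_image intro: span_base intro!: span_neg)
    qed simp
    finally show ?thesis using that by blast
  qed
  have "csubspace (span ?B)"
    unfolding complex_vector.subspace_def
  proof (intro conjI ballI allI)
    fix c x assume x: "x \<in> span ?B"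
    show "c *\<^sub>C x \<in> span ?B"
      unfolding scaleC_eq_Re_Im[of c x] using x i by (intro span_add span_scale)
  qed (auto intro: span_add span_zero)
  then have "cspan B \<subseteq> span ?B"
    by (intro complex_vector.span_minimal) (auto intro: span_base)
  with B show ?thesis by (intro that[of ?B]) auto
qed

lemma delta_eq: "delta W = (\<lambda>x. \<chi> i. cblinfun_apply (W $ i) x)"
  by (simp add: fun_eq_iff delta_def)

lemma linear_delta: "linear (delta W)"
  by (auto simp: linear_iff delta_def vec_eq_iff linear_add[OF linear_cblinfun_apply]
      linear_scale[OF linear_cblinfun_apply])

text \<open>
  If all images of \<open>A\<close> under the \<open>W $ i\<close> have finite-dimensional span, so has \<open>A\<close>, because \<open>delta W\<close>
  has a finite-dimensional kernel. Hence \<open>commuting_Nakayama\<close> applies to the operators acting on sets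
  by taking images; their \<open>k\<close>-th powers send the kernel in question to \<open>{0}\<close>.
\<close>

lemma tuple_ker_pow_finite_dim:
  fixes W :: "('a::complex_normed_vector, 'n::finite) op_tuple"
  assumes W: "W \<in> commuting_tuples" and fin: "cfinite_dim (tuple_ker W)"
  obtains B where "finite B" "tuple_ker (tuple_pow W k) = span B"
proof -
  define Z where "Z = {A :: 'a set. \<exists>B. finite B \<and> A \<subseteq> span B}"
  have "tuple_ker (tuple_pow W k) \<in> Z"
  proof (rule commuting_Nakayama[where W = "\<lambda>i A. cblinfun_apply (W $ i) ` A" and k = "\<lambda>_. k"])
    show "cblinfun_apply (W $ i) ` cblinfun_apply (W $ j) ` A
        = cblinfun_apply (W $ j) ` cblinfun_apply (W $ i) ` A" for i j A
      by (simp add: image_image commuting_tuples_apply[OF W])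
  next
    fix i A assume "A \<in> Z"
    then obtain B where "finite B" "A \<subseteq> span B" by (auto simp: Z_def)
    then show "cblinfun_apply (W $ i) ` A \<in> Z"
      unfolding Z_def using linear_span_image[OF linear_cblinfun_apply, of "W $ i" B]
      by (auto intro!: exI[of _ "cblinfun_apply (W $ i) ` B"])
  next
    fix A assume "\<And>i. cblinfun_apply (W $ i) ` A \<in> Z"
    then have "\<forall>i. \<exists>B. finite B \<and> cblinfun_apply (W $ i) ` A \<subseteq> span B" by (simp add: Z_def)
    then obtain B where B: "\<And>i. finite (B i)" "\<And>i. cblinfun_apply (W $ i) ` A \<subseteq> span (B i)"
      by metis
    obtain B' :: "('a ^ 'n) set" where B': "finite B'" "span B' = {z. \<forall>i. z $ i \<in> span (\<Union>(range B))}"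
      using vectors_over_finite_span[of "\<Union>(range B)"] B(1) by auto
    have "cblinfun_apply (W $ i) ` A \<subseteq> span (\<Union>(range B))" for i
      using B(2)[of i] span_mono[of "B i" "\<Union>(range B)"] by blast
    then have im: "delta W ` A \<subseteq> span B'" unfolding B'(2) by (simp add: delta_def image_subset_iff)
    obtain K where K: "finite K" "tuple_ker W \<subseteq> span K"
      using cfinite_dim_imp_finite_span[OF fin] .
    have "{x. delta W x = 0} \<subseteq> span K"
      using K(2) by (auto simp: delta_def vec_eq_iff tuple_ker_def op_ker_def)
    then obtain C where "finite C" "A \<subseteq> span C"
      using finite_span_of_image_and_kernel[OF linear_delta B'(1) im K(1)] by metis
    then show "A \<in> Z" by (auto simp: Z_def)
  next
    fix i
    have "((\<lambda>A. cblinfun_apply (W $ i) ` A) ^^ m) A = (cblinfun_apply (W $ i) ^^ m) ` A" for m A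
      by (induction m) (simp_all add: image_comp)
    then have "((\<lambda>A. cblinfun_apply (W $ i) ` A) ^^ k) (tuple_ker (tuple_pow W k)) \<subseteq> span {}"
      by (auto simp: mem_tuple_ker_pow)
    then show "((\<lambda>A. cblinfun_apply (W $ i) ` A) ^^ k) (tuple_ker (tuple_pow W k)) \<in> Z"
      unfolding Z_def by blast
  qed
  then obtain B where "finite B" "tuple_ker (tuple_pow W k) \<subseteq> span B" by (auto simp: Z_def)
  from subspace_within_finite_span[OF csubspace_imp_subspace[OF csubspace_tuple_ker] this]
  show ?thesis using that by metis
qed

section \<open>Duality between generalized kernel and generalized range\<close>

text \<open>
  Modulo the stable kernel the tuple is bounded below, and so are its powers. A functional that
  vanishes on this kernel is therefore controlled by \<open>x \<mapsto> (W\<^sub>i\<^sup>k x)\<^sub>i\<close> for each \<open>k\<close>, and factors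
  through it.
\<close>

lemma annihilator_subset_tuple_ran_inf_dual:
  fixes W :: "('a::cbanach, 'n::finite) op_tuple"
  assumes W: "W \<in> Phi_plus"
    and stable: "tuple_ker (tuple_pow W p) = tuple_ker (tuple_pow W (p + 1))"
    and f: "\<And>v. v \<in> tuple_ker (tuple_pow W p) \<Longrightarrow> cblinfun_apply f v = 0"
  shows "f \<in> tuple_ran_inf (tuple_dual W)"
proof -
  have comm: "W \<in> commuting_tuples" and fin: "cfinite_dim (tuple_ker W)"
    and closed: "closed (range (\<lambda>x. \<chi> i. cblinfun_apply (W $ i) x))"
    using W by (auto simp: Phi_plus_def delta_eq)
  obtain B where B: "finite B" and N: "tuple_ker (tuple_pow W p) = span B"
    using tuple_ker_pow_finite_dim[OF comm fin] .
  obtain L where L: "L \<ge> 0" "\<And>x. norm (cblinfun_apply f x) \<le> norm x * L"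
    using bounded_linear.nonneg_bounded[OF bounded_linear_cblinfun_apply] by blast
  have "f \<in> tuple_ran (tuple_pow (tuple_dual W) k)" for k
  proof -
    obtain C where C: "C \<ge> 0" and low: "\<And>x. \<exists>v\<in>span B. norm (x - v)
        \<le> C * (\<Sum>i\<in>UNIV. norm ((cblinfun_apply (W $ i) ^^ k) x))"
      using tuple_powers_bounded_below_modulo_finite_span[OF bounded_linear_cblinfun_apply
          commuting_tuples_apply[OF comm] closed B, of k]
        tuple_ker_pow_invariant[OF commuting_tuples_apply[OF comm], of _ p] tuple_ker_pow_reflects[OF comm stable]
      unfolding N by metis
    have "norm (cblinfun_apply f x) \<le> (C * L) * (\<Sum>i\<in>UNIV. norm (cblinfun_apply (op_pow (W $ i) k) x))"
      for x
    proof -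
      obtain v where v: "v \<in> span B"
        "norm (x - v) \<le> C * (\<Sum>i\<in>UNIV. norm ((cblinfun_apply (W $ i) ^^ k) x))"
        using low by blast
      have "cblinfun_apply f x = cblinfun_apply f (x - v)"
        using f[of v] v(1) by (simp add: N linear_diff[OF linear_cblinfun_apply])
      then have "norm (cblinfun_apply f x) \<le> norm (x - v) * L" using L(2) by simp
      also have "\<dots> \<le> C * (\<Sum>i\<in>UNIV. norm ((cblinfun_apply (W $ i) ^^ k) x)) * L"
        using v(2) L(1) by (rule mult_right_mono)
      finally show ?thesis by (simp add: op_pow_apply mult_ac)
    qed
    then obtain g :: "'n \<Rightarrow> 'a cdual" where "f = (\<Sum>i\<in>UNIV. g i o\<^sub>C\<^sub>L op_pow (W $ i) k)"
      using complex_functional_factors_through_tuple[of "C * L" f "\<lambda>i. op_pow (W $ i) k"] C L(1)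
      by auto
    then show ?thesis
      by (auto simp: tuple_ran_def tuple_pow_def tuple_dual_def op_ran_def set_sum_alt
          op_pow_dual_apply)
  qed
  then show ?thesis by (simp add: tuple_ran_inf_def)
qed

lemma tuple_ran_inf_dual_annihilates_tuple_ker_pow:
  assumes f: "f \<in> tuple_ran_inf (tuple_dual W)" and v: "v \<in> tuple_ker (tuple_pow W k)"
  shows "cblinfun_apply f v = 0"
proof -
  have "f \<in> (\<Sum>i\<in>UNIV. op_ran (op_pow (dual_op (W $ i)) k))"
    using f by (auto simp: tuple_ran_inf_def tuple_ran_def tuple_pow_def tuple_dual_def)
  then obtain s where s: "f = sum s UNIV" "\<And>i. s i \<in> op_ran (op_pow (dual_op (W $ i)) k)"
    by (auto simp: set_sum_alt)
  have "cblinfun_apply (s i) v = 0" for i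
  proof -
    obtain g where "s i = g o\<^sub>C\<^sub>L op_pow (W $ i) k"
      using s(2)[of i] by (auto simp: op_ran_def op_pow_dual_apply)
    then show ?thesis
      using v by (simp add: cblinfun_compose.rep_eq op_pow_apply mem_tuple_ker_pow
          linear_0[OF linear_cblinfun_apply])
  qed
  then show ?thesis by (simp add: s(1) cblinfun_apply_sum)
qed

section \<open>Small perturbations preserve finite ascent\<close>

lemma cblinfun_compose_add_left: "(A + B) o\<^sub>C\<^sub>L C = (A o\<^sub>C\<^sub>L C) + (B o\<^sub>C\<^sub>L C)"
  by transfer simp

lemma cblinfun_compose_add_right: "A o\<^sub>C\<^sub>L (B + C) = (A o\<^sub>C\<^sub>L B) + (A o\<^sub>C\<^sub>L C)"
  by transfer (simp add: bounded_clinear_bounded_linear linear_add bounded_linear.linear)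

lemma cblinfun_compose_scaleR_left: "(r *\<^sub>R A) o\<^sub>C\<^sub>L B = r *\<^sub>R (A o\<^sub>C\<^sub>L B)"
  by transfer simp

lemma cblinfun_compose_scaleR_right: "A o\<^sub>C\<^sub>L (r *\<^sub>R B) = r *\<^sub>R (A o\<^sub>C\<^sub>L B)"
  by transfer (simp add: bounded_clinear_bounded_linear linear_scale bounded_linear.linear)

lemma mutually_commuting_apply:
  "mutually_commuting W V \<Longrightarrow>
    cblinfun_apply (W $ i) (cblinfun_apply (V $ j) x) = cblinfun_apply (V $ j) (cblinfun_apply (W $ i) x)"
  unfolding mutually_commuting_def by (metis (mono_tags, lifting) cblinfun_compose.rep_eq)

lemma mutually_commuting_sym: "mutually_commuting W V \<Longrightarrow> mutually_commuting V W"
  by (simp add: mutually_commuting_def)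

lemma mutually_commuting_self_iff: "mutually_commuting T T \<longleftrightarrow> T \<in> commuting_tuples"
  by (simp add: mutually_commuting_def commuting_tuples_def)

lemma mutually_commuting_add_left:
  "mutually_commuting T V \<Longrightarrow> mutually_commuting S V \<Longrightarrow> mutually_commuting (T + S) V"
  by (simp add: mutually_commuting_def cblinfun_compose_add_left cblinfun_compose_add_right)

lemma commuting_tuples_add:
  assumes "W \<in> commuting_tuples" "V \<in> commuting_tuples" "mutually_commuting W V"
  shows "W + V \<in> commuting_tuples"
  using assms
  by (simp add: commuting_tuples_def mutually_commuting_def cblinfun_compose_add_left
      cblinfun_compose_add_right add_ac)

text \<open>
  The conditions that membership of \<open>T\<close> in \<open>K_class\<close> imposes on one perturbation \<open>S\<close>.
\<close>

definition K_conditions ::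
  "('a::complex_normed_vector, 'n::{finite,linorder}) op_tuple \<Rightarrow> ('a, 'n) op_tuple \<Rightarrow> bool" where
  "K_conditions T S \<longleftrightarrow>
      essentially_Kato (T + S) \<and>
      (\<Sum>i\<in>UNIV. cblinfun_apply (dual_op (T $ i) + dual_op (S $ i)) ` tuple_ran_inf (tuple_dual T))
        = tuple_ran_inf (tuple_dual T) \<and>
      cblinfun_apply (tuple_prod (T + S)) ` (tuple_ran_inf (T + S) \<inter> tuple_ker_inf (T + S))
        = tuple_ran_inf (T + S) \<inter> tuple_ker_inf (T + S) \<and>
      (\<forall>k i. closed (op_ran (op_pow (dual_op (T $ i) + dual_op (S $ i)) k)) \<and>
             closed (op_ran (op_pow (dual_op (T $ i)) k))) \<and>
      (\<forall>k p. closed (tuple_ran (tuple_pow (T + S) k)) \<and>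
             closed (\<Sum>i\<in>{..p}. op_ker (op_pow (T $ i) k)) \<and>
             closed (\<Sum>i\<in>{..p}. op_ker (op_pow (T $ i + S $ i) k)))"

lemma K_class_iff:
  "T \<in> K_class \<alpha> \<longleftrightarrow> T \<in> commuting_tuples \<and> (\<exists>\<epsilon>>\<alpha>. \<forall>S\<in>commuting_tuples.
    tuple_norm S < \<epsilon> \<and> mutually_commuting T S \<longrightarrow> K_conditions T S)"
  unfolding K_class_def K_conditions_def mem_Collect_eq ..

text \<open>
  The radius \<open>\<alpha>\<close> in this step comes from the class alone and is independent of the lower bound of
  the particular tuple \<open>W\<close>; so it does not shrink along a path inside the class.
\<close>

theorem ascent_finite_add:
  fixes W V :: "('a::cbanach, 'n::{finite,linorder}) op_tuple"
  assumes W: "W \<in> Phi_plus" "W \<in> K_class \<alpha>" and asc: "ascent W < \<infinity>"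
    and V: "V \<in> commuting_tuples" "mutually_commuting W V" "tuple_norm V \<le> \<alpha>"
  shows "ascent (W + V) < \<infinity>"
proof -
  have comm: "W \<in> commuting_tuples" and fin: "cfinite_dim (tuple_ker W)"
    using W(1) by (auto simp: Phi_plus_def)
  obtain p where stable: "tuple_ker (tuple_pow W p) = tuple_ker (tuple_pow W (p + 1))"
    using asc unfolding ascent_finite_iff by blast
  let ?N = "tuple_ker (tuple_pow W p)"
  let ?R = "tuple_ran_inf (tuple_dual W)"
  obtain B where B: "finite B" and N: "?N = span B"
    using tuple_ker_pow_finite_dim[OF comm fin] .
  obtain \<epsilon> where "\<alpha> < \<epsilon>" and K: "\<And>V. V \<in> commuting_tuples \<Longrightarrow>
      tuple_norm V < \<epsilon> \<Longrightarrow> mutually_commuting W V \<Longrightarrow> K_conditions W V"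
    using W(2) unfolding K_class_iff by blast
  have "K_conditions W V" using V \<open>\<alpha> < \<epsilon>\<close> by (intro K) simp_all
  then have dual_surj:
    "(\<Sum>i\<in>UNIV. cblinfun_apply (dual_op (W $ i) + dual_op (V $ i)) ` ?R) = ?R"
    unfolding K_conditions_def by (elim conjE)
  have reflects: "x \<in> ?N" if x: "\<And>i. cblinfun_apply ((W + V) $ i) x \<in> ?N" for x
  proof (rule ccontr)
    assume x_notin: "x \<notin> ?N"
    have closed: "closed ?N" unfolding N by (rule closed_finite_span[OF B])
    obtain f :: "'a cdual"
      where f0: "\<And>v. v \<in> ?N \<Longrightarrow> cblinfun_apply f v = 0" and fx: "cblinfun_apply f x \<noteq> 0"
      using complex_functional_separating_point_from_closed_subspace[OF csubspace_tuple_ker closed x_notin]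
      by blast
    have "f \<in> ?R" using annihilator_subset_tuple_ran_inf_dual[OF W(1) stable f0] .
    then have "f \<in> (\<Sum>i\<in>UNIV. cblinfun_apply (dual_op (W $ i) + dual_op (V $ i)) ` ?R)"
      by (simp only: dual_surj)
    then obtain s where f: "f = sum s UNIV"
      and s: "\<And>i. s i \<in> cblinfun_apply (dual_op (W $ i) + dual_op (V $ i)) ` ?R"
      by (auto simp: set_sum_alt)
    have "cblinfun_apply (s i) x = 0" for i
    proof -
      obtain g where g: "g \<in> ?R" "s i = cblinfun_apply (dual_op (W $ i) + dual_op (V $ i)) g"
        using s[of i] by blast
      have "cblinfun_apply (s i) x = cblinfun_apply g (cblinfun_apply ((W + V) $ i) x)"
        by (simp add: g(2) plus_cblinfun.rep_eq dual_op_apply cblinfun_compose.rep_eq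
            linear_add[OF linear_cblinfun_apply])
      also have "\<dots> = 0"
        by (rule tuple_ran_inf_dual_annihilates_tuple_ker_pow[OF g(1) x])
      finally show ?thesis .
    qed
    then have "cblinfun_apply f x = 0" by (simp add: f cblinfun_apply_sum)
    with fx show False by contradiction
  qed
  have comm_add: "W + V \<in> commuting_tuples" using commuting_tuples_add[OF comm V(1,2)] .
  have "x \<in> ?N" if x: "x \<in> tuple_ker_inf (W + V)" for x
  proof -
    obtain k where "x \<in> tuple_ker (tuple_pow (W + V) k)"
      using x unfolding tuple_ker_inf_def by blast
    then have k: "(cblinfun_apply ((W + V) $ i) ^^ k) x = 0" for i
      unfolding mem_tuple_ker_pow by (rule spec)
    show ?thesis
    proof (rule commuting_Nakayama[where W = "\<lambda>i. cblinfun_apply ((W + V) $ i)" and k = "\<lambda>_. k"])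
      show "(cblinfun_apply ((W + V) $ i) ^^ k) x \<in> ?N" for i
        unfolding k by (rule complex_vector.subspace_0[OF csubspace_tuple_ker])
      show "cblinfun_apply ((W + V) $ i) y \<in> ?N" if "y \<in> ?N" for i y
        using that
      proof (rule tuple_ker_pow_invariant[rotated])
        show "cblinfun_apply ((W + V) $ i) (cblinfun_apply (W $ j) z)
            = cblinfun_apply (W $ j) (cblinfun_apply ((W + V) $ i) z)" for j z
          by (simp add: plus_cblinfun.rep_eq linear_add[OF linear_cblinfun_apply]
              commuting_tuples_apply[OF comm, of i j] mutually_commuting_apply[OF V(2), of j i])
      qed
    qed (rule commuting_tuples_apply[OF comm_add], erule reflects)
  qed
  then have "tuple_ker_inf (W + V) \<subseteq> span B" unfolding N by blast
  then show ?thesis by (rule ascent_finite_if_tuple_ker_inf_finite_dim[OF B])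
qed

section \<open>Scaling of tuples\<close>

lemma op_pow_scaleR: "op_pow (r *\<^sub>R A) k = r ^ k *\<^sub>R op_pow A k"
  by (induction k) (simp_all add: cblinfun_compose_scaleR_left cblinfun_compose_scaleR_right)

lemma op_ker_scaleR: "r \<noteq> 0 \<Longrightarrow> op_ker (r *\<^sub>R A) = op_ker A"
  by (simp add: op_ker_def scaleR_cblinfun.rep_eq)

lemma image_scaleR_cblinfun:
  assumes "r \<noteq> 0" "subspace M"
  shows "cblinfun_apply (r *\<^sub>R A) ` M = cblinfun_apply A ` M"
proof -
  have *: "cblinfun_apply (s *\<^sub>R C) ` M \<subseteq> cblinfun_apply C ` M"
    for s and C :: "'a \<Rightarrow>\<^sub>C\<^sub>L 'b"
    using subspace_scale[OF assms(2)]
    by (auto simp: scaleR_cblinfun.rep_eq simp flip: linear_scale[OF linear_cblinfun_apply])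
  show ?thesis using *[of r A] *[of "1 / r" "r *\<^sub>R A"] assms(1) by auto
qed

lemma op_ran_scaleR: "r \<noteq> 0 \<Longrightarrow> op_ran (r *\<^sub>R A) = op_ran A"
  unfolding op_ran_def by (rule image_scaleR_cblinfun) simp_all

lemma tuple_ker_scaleR: "r \<noteq> 0 \<Longrightarrow> tuple_ker (r *\<^sub>R T) = tuple_ker T"
  by (simp add: tuple_ker_def op_ker_scaleR)

lemma tuple_ran_scaleR: "r \<noteq> 0 \<Longrightarrow> tuple_ran (r *\<^sub>R T) = tuple_ran T"
  by (simp add: tuple_ran_def op_ran_scaleR)

lemma tuple_pow_scaleR: "tuple_pow (r *\<^sub>R T) k = r ^ k *\<^sub>R tuple_pow T k"
  by (simp add: tuple_pow_def vec_eq_iff op_pow_scaleR)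

lemma tuple_ker_inf_scaleR: "r \<noteq> 0 \<Longrightarrow> tuple_ker_inf (r *\<^sub>R T) = tuple_ker_inf T"
  by (simp add: tuple_ker_inf_def tuple_pow_scaleR tuple_ker_scaleR)

lemma tuple_ran_inf_scaleR: "r \<noteq> 0 \<Longrightarrow> tuple_ran_inf (r *\<^sub>R T) = tuple_ran_inf T"
  by (simp add: tuple_ran_inf_def tuple_pow_scaleR tuple_ran_scaleR)

lemma ascent_scaleR: "r \<noteq> 0 \<Longrightarrow> ascent (r *\<^sub>R T) = ascent T"
proof -
  assume "r \<noteq> 0"
  then have "tuple_ker (tuple_pow (r *\<^sub>R T) k) = tuple_ker (tuple_pow T k)" for k
    by (simp add: tuple_pow_scaleR tuple_ker_scaleR)
  then show ?thesis by (simp only: ascent_def)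
qed

lemma dual_op_scaleR: "dual_op (r *\<^sub>R A) = r *\<^sub>R dual_op A"
  by (intro cblinfun_apply_inject[THEN iffD1] ext)
    (simp add: dual_op_apply scaleR_cblinfun.rep_eq cblinfun_compose_scaleR_right)

lemma tuple_dual_scaleR: "tuple_dual (r *\<^sub>R T) = r *\<^sub>R tuple_dual T"
  by (simp add: tuple_dual_def vec_eq_iff dual_op_scaleR)

lemma tuple_prod_scaleR: "tuple_prod (r *\<^sub>R T :: ('a::complex_normed_vector, 'n::{finite,linorder}) op_tuple)
    = r ^ CARD('n) *\<^sub>R tuple_prod T"
proof -
  have "foldr (\<lambda>i A. (r *\<^sub>R T) $ i o\<^sub>C\<^sub>L A) is cblinfun_id
      = r ^ length is *\<^sub>R foldr (\<lambda>i A. T $ i o\<^sub>C\<^sub>L A) is cblinfun_id" for "is"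
    by (induction "is") (simp_all add: cblinfun_compose_scaleR_left cblinfun_compose_scaleR_right)
  then show ?thesis by (simp add: tuple_prod_def)
qed

lemma commuting_tuples_scaleR: "T \<in> commuting_tuples \<Longrightarrow> r *\<^sub>R T \<in> commuting_tuples"
  by (simp add: commuting_tuples_def cblinfun_compose_scaleR_left cblinfun_compose_scaleR_right)

lemma mutually_commuting_scaleR_left: "mutually_commuting T S \<Longrightarrow> mutually_commuting (r *\<^sub>R T) S"
  and mutually_commuting_scaleR_right: "mutually_commuting T S \<Longrightarrow> mutually_commuting T (r *\<^sub>R S)"
  by (simp_all add: mutually_commuting_def cblinfun_compose_scaleR_left cblinfun_compose_scaleR_right)

lemma tuple_norm_scaleR: "tuple_norm (r *\<^sub>R T) = \<bar>r\<bar> * tuple_norm T"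
  by (simp add: tuple_norm_def sum_distrib_left)

lemma range_delta_scaleR:
  assumes "r \<noteq> 0"
  shows "range (delta (r *\<^sub>R T)) = range (delta T)"
proof -
  have "delta (r *\<^sub>R T) = (\<lambda>x. delta T (r *\<^sub>R x))"
    by (simp add: fun_eq_iff delta_def vec_eq_iff scaleR_cblinfun.rep_eq
        linear_scale[OF linear_cblinfun_apply])
  then have "range (delta (r *\<^sub>R T)) = delta T ` range (\<lambda>x. r *\<^sub>R x)"
    by (simp add: image_image)
  also have "range (\<lambda>x :: 'a. r *\<^sub>R x) = UNIV"
    using assms by (intro surjI[of _ "\<lambda>x. (1 / r) *\<^sub>R x"]) simp
  finally show ?thesis .
qed

lemma subspace_sum_of_subspaces:
  assumes "\<And>i. subspace (V i)"
  shows "subspace (\<Sum>i\<in>I. V i)"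
proof (induction I rule: infinite_finite_induct)
  case (insert i I)
  have "subspace (V i + (\<Sum>i\<in>I. V i))"
    using subspace_sums[OF assms[of i] insert.IH]
    by (rule back_subst[of subspace]) (auto simp: set_plus_def)
  then show ?case using insert.hyps by simp
qed auto

lemma subspace_tuple_ran_inf: "subspace (tuple_ran_inf T)"
  unfolding tuple_ran_inf_def tuple_ran_def op_ran_def
  by (intro subspace_Inter ballI) (auto intro!: subspace_sum_of_subspaces linear_subspace_image linear_cblinfun_apply)

lemma Phi_plus_scaleR: "r \<noteq> 0 \<Longrightarrow> T \<in> Phi_plus \<Longrightarrow> r *\<^sub>R T \<in> Phi_plus"
  by (simp add: Phi_plus_def commuting_tuples_scaleR tuple_ker_scaleR range_delta_scaleR)

lemma essentially_Kato_scaleR: "r \<noteq> 0 \<Longrightarrow> essentially_Kato T \<Longrightarrow> essentially_Kato (r *\<^sub>R T)"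
  by (simp add: essentially_Kato_def commuting_tuples_scaleR tuple_ker_inf_scaleR
      tuple_ran_inf_scaleR tuple_ran_scaleR)

lemma C_class_scaleR:
  fixes T :: "('a::complex_normed_vector, 'n::finite) op_tuple"
  assumes r: "r \<noteq> 0" and T: "T \<in> C_class"
  shows "r *\<^sub>R T \<in> C_class"
proof -
  let ?U = "r *\<^sub>R T"
  have "\<exists>k0. \<forall>k\<ge>k0. \<forall>i j. i \<noteq> j \<longrightarrow>
      cblinfun_apply (op_pow (T $ i) k) ` op_ker (op_pow (T $ i) (k + 1)) \<subseteq> op_ker (T $ j)"
    using T by (simp only: C_class_def mem_Collect_eq)
  then obtain k0 where k0: "\<forall>k\<ge>k0. \<forall>i j. i \<noteq> j \<longrightarrow>
      cblinfun_apply (op_pow (T $ i) k) ` op_ker (op_pow (T $ i) (k + 1)) \<subseteq> op_ker (T $ j)" ..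
  have "\<exists>m. \<forall>p\<ge>m. \<exists>A\<in>commuting_tuples. mutually_commuting A T \<and> tuple_ker A = {0} \<and>
      delta A ` (tuple_ker (tuple_pow T p) \<inter> tuple_ran (tuple_pow T p)) \<subseteq> range (delta (tuple_pow T p))"
    using T by (simp only: C_class_def mem_Collect_eq)
  then obtain m where m: "\<forall>p\<ge>m. \<exists>A\<in>commuting_tuples. mutually_commuting A T \<and> tuple_ker A = {0} \<and>
      delta A ` (tuple_ker (tuple_pow T p) \<inter> tuple_ran (tuple_pow T p)) \<subseteq> range (delta (tuple_pow T p))" ..
  have "cblinfun_apply (op_pow (?U $ i) k) ` op_ker (op_pow (?U $ i) (k + 1)) \<subseteq> op_ker (?U $ j)"
    if "k0 \<le> k" "i \<noteq> j" for k i j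
  proof -
    have "cblinfun_apply (r ^ k *\<^sub>R op_pow (T $ i) k) ` op_ker (op_pow (T $ i) (k + 1))
        = cblinfun_apply (op_pow (T $ i) k) ` op_ker (op_pow (T $ i) (k + 1))"
      using r by (intro image_scaleR_cblinfun csubspace_imp_subspace csubspace_op_ker) simp
    moreover have "op_ker (r ^ (k + 1) *\<^sub>R op_pow (T $ i) (k + 1)) = op_ker (op_pow (T $ i) (k + 1))"
      using r by (intro op_ker_scaleR power_not_zero)
    ultimately show ?thesis
      unfolding vector_scaleR_component op_pow_scaleR op_ker_scaleR[OF r]
      using k0[rule_format, OF that] by simp
  qed
  moreover have "\<exists>A\<in>commuting_tuples. mutually_commuting A ?U \<and> tuple_ker A = {0} \<and>
      delta A ` (tuple_ker (tuple_pow ?U p) \<inter> tuple_ran (tuple_pow ?U p)) \<subseteq> range (delta (tuple_pow ?U p))"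
    if "m \<le> p" for p
  proof -
    obtain A where A: "A \<in> commuting_tuples" "mutually_commuting A T" "tuple_ker A = {0}"
      "delta A ` (tuple_ker (tuple_pow T p) \<inter> tuple_ran (tuple_pow T p)) \<subseteq> range (delta (tuple_pow T p))"
      using m[rule_format, OF \<open>m \<le> p\<close>] by blast
    then show ?thesis
      using mutually_commuting_scaleR_right[OF A(2)] r
      by (intro bexI[OF _ A(1)])
        (simp only: tuple_pow_scaleR tuple_ker_scaleR tuple_ran_scaleR range_delta_scaleR
          power_not_zero simp_thms)
  qed
  moreover have "?U \<in> Phi_plus" "?U \<in> commuting_tuples"
    using T r by (simp_all add: C_class_def Phi_plus_scaleR commuting_tuples_scaleR)
  ultimately show ?thesis unfolding C_class_def mem_Collect_eq by meson
qed

text \<open>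
  Kernels and ranges do not see nonzero scalars, nor does the image of a subspace under an operator.
\<close>

lemma K_conditions_scaleR:
  fixes T S :: "('a::complex_normed_vector, 'n::{finite,linorder}) op_tuple"
  assumes r: "r \<noteq> 0" and K: "K_conditions T S"
  shows "K_conditions (r *\<^sub>R T) (r *\<^sub>R S)"
proof -
  have dual_images: "cblinfun_apply (r *\<^sub>R A) ` tuple_ran_inf U = cblinfun_apply A ` tuple_ran_inf U"
    for A :: "'a cdual \<Rightarrow>\<^sub>C\<^sub>L 'a cdual" and U :: "('a cdual, 'n) op_tuple"
    using r by (intro image_scaleR_cblinfun subspace_tuple_ran_inf)
  have images: "cblinfun_apply (r ^ m *\<^sub>R A) ` (tuple_ran_inf U \<inter> tuple_ker_inf U)
      = cblinfun_apply A ` (tuple_ran_inf U \<inter> tuple_ker_inf U)"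
    for m and A :: "'a \<Rightarrow>\<^sub>C\<^sub>L 'a" and U :: "('a, 'n) op_tuple"
    using r by (intro image_scaleR_cblinfun subspace_inter subspace_tuple_ran_inf subspace_tuple_ker_inf) simp
  have sums: "r *\<^sub>R T + r *\<^sub>R S = r *\<^sub>R (T + S)"
    "dual_op ((r *\<^sub>R T) $ i) + dual_op ((r *\<^sub>R S) $ i) = r *\<^sub>R (dual_op (T $ i) + dual_op (S $ i))"
    "(r *\<^sub>R T) $ i + (r *\<^sub>R S) $ i = r *\<^sub>R (T $ i + S $ i)" for i
    by (simp_all add: scaleR_add_right dual_op_scaleR)
  note scale = dual_op_scaleR tuple_dual_scaleR tuple_ran_inf_scaleR tuple_ker_inf_scaleR
    tuple_prod_scaleR op_pow_scaleR op_ran_scaleR op_ker_scaleR tuple_pow_scaleR tuple_ran_scaleR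
    vector_scaleR_component power_not_zero
  show ?thesis
    unfolding K_conditions_def sums
    using K[unfolded K_conditions_def] r essentially_Kato_scaleR[OF r, of "T + S"]
    by (simp only: scale dual_images images not_False_eq_True simp_thms)
qed

lemma K_class_scaleR:
  fixes T :: "('a::complex_normed_vector, 'n::{finite,linorder}) op_tuple"
  assumes r: "r > 0" and T: "T \<in> K_class \<alpha>"
  shows "r *\<^sub>R T \<in> K_class (r * \<alpha>)"
proof -
  from T obtain \<epsilon> where "\<alpha> < \<epsilon>" and K: "\<And>S. S \<in> commuting_tuples \<Longrightarrow>
      tuple_norm S < \<epsilon> \<Longrightarrow> mutually_commuting T S \<Longrightarrow> K_conditions T S"
    and comm: "T \<in> commuting_tuples"
    unfolding K_class_iff by blast
  have "K_conditions (r *\<^sub>R T) S"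
    if S: "S \<in> commuting_tuples" "tuple_norm S < r * \<epsilon>" "mutually_commuting (r *\<^sub>R T) S" for S
  proof -
    have "mutually_commuting ((1 / r) *\<^sub>R r *\<^sub>R T) ((1 / r) *\<^sub>R S)"
      by (intro mutually_commuting_scaleR_left mutually_commuting_scaleR_right S)
    then have "K_conditions T ((1 / r) *\<^sub>R S)"
      using r S(2) by (intro K commuting_tuples_scaleR S) (simp_all add: tuple_norm_scaleR field_simps)
    then have "K_conditions (r *\<^sub>R T) (r *\<^sub>R (1 / r) *\<^sub>R S)"
      using r by (intro K_conditions_scaleR) simp_all
    then show ?thesis using r by simp
  qed
  moreover have "r * \<alpha> < r * \<epsilon>" using r \<open>\<alpha> < \<epsilon>\<close> by simp
  ultimately show ?thesis
    unfolding K_class_iff using commuting_tuples_scaleR[OF comm] by blast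
qed

lemma K_class_antimono: "\<alpha> \<le> \<beta> \<Longrightarrow> K_class \<beta> \<subseteq> K_class \<alpha>"
  unfolding subset_iff K_class_iff using le_less_trans by blast

text \<open>
  Scaling by \<open>r\<close> enlarges the admissible radius by the factor \<open>r\<close>; \<open>1 \<le> r\<close> is what keeps it
  above \<open>\<alpha>\<close>.
\<close>

lemma G_class_scaleR:
  assumes "0 \<le> \<alpha>" "1 \<le> r" "T \<in> G_class \<alpha>"
  shows "r *\<^sub>R T \<in> G_class \<alpha>"
proof -
  have "\<alpha> \<le> r * \<alpha>" using assms(1,2) mult_right_mono[of 1 r \<alpha>] by simp
  then have "r *\<^sub>R T \<in> K_class \<alpha>"
    using assms K_class_scaleR[of r T \<alpha>] K_class_antimono[of \<alpha> "r * \<alpha>"] by (auto simp: G_class_def)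
  moreover have "r *\<^sub>R T \<in> C_class" using assms by (intro C_class_scaleR) (auto simp: G_class_def)
  ultimately show ?thesis by (simp add: G_class_def)
qed

section \<open>Perturbations of any size\<close>

theorem theorem4p2:
  fixes T S :: "('a::cbanach, 'n::{finite,linorder}) op_tuple"
    and \<alpha> :: real
  assumes "\<alpha> > 0"
    and "T \<in> commuting_tuples"
    and "S \<in> commuting_tuples"
    and "mutually_commuting T S"
    and "T \<in> G_class \<alpha>"
    and "ascent T < \<infinity>"
    and "S \<in> perturbation_class (G_class \<alpha>)"
  shows "ascent (T + S) < \<infinity>"
proof -
  have Phi: "W \<in> Phi_plus" if "W \<in> G_class \<alpha>" for W :: "('a, 'n) op_tuple"
    using that by (simp add: G_class_def C_class_def)
  have path: "r *\<^sub>R T + S \<in> G_class \<alpha>" if "1 \<le> r" for r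
  proof -
    have "mutually_commuting S (r *\<^sub>R T)"
      by (rule mutually_commuting_scaleR_right[OF mutually_commuting_sym[OF assms(4)]])
    then have "S + r *\<^sub>R T \<in> G_class \<alpha>"
      using assms(7) G_class_scaleR[OF _ that assms(5)] assms(1) by (auto simp: perturbation_class_def)
    then show ?thesis by (simp add: add.commute)
  qed
  \<comment> \<open>For this \<open>L\<close> the radius \<open>L * \<alpha>\<close> of \<open>L *\<^sub>R T\<close> accommodates all of \<open>S\<close>.\<close>
  define L where "L = max 1 (tuple_norm S / \<alpha>)"
  have L: "1 \<le> L" "tuple_norm S \<le> L * \<alpha>"
    using assms(1) by (auto simp: L_def max_def field_simps)
  obtain m :: nat where m: "0 < m" "(L - 1) * tuple_norm T / \<alpha> \<le> real m"
  proof -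
    obtain m :: nat where "(L - 1) * tuple_norm T / \<alpha> \<le> real m" using real_arch_simple by blast
    then show ?thesis by (intro that[of "Suc m"]) auto
  qed
  \<comment> \<open>Going down from \<open>L\<close> to \<open>1\<close> in \<open>m\<close> equal steps changes the tuple by at most \<open>\<alpha>\<close> each time.\<close>
  define h where "h = (L - 1) / real m"
  have h: "0 \<le> h" "h * tuple_norm T \<le> \<alpha>" "real m * h = L - 1"
    using L(1) m assms(1) by (simp_all add: h_def field_simps)
  have "ascent ((L - real j * h) *\<^sub>R T + S) < \<infinity>" if "j \<le> m" for j
    using that
  proof (induction j)
    case 0
    have "ascent (L *\<^sub>R T + S) < \<infinity>"
    proof (rule ascent_finite_add)
      show "L *\<^sub>R T \<in> Phi_plus"
        using Phi G_class_scaleR[OF _ L(1) assms(5)] assms(1) by simp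
      show "L *\<^sub>R T \<in> K_class (L * \<alpha>)"
        using K_class_scaleR[of L T \<alpha>] L(1) assms(5) by (simp add: G_class_def)
      show "ascent (L *\<^sub>R T) < \<infinity>"
        using assms(6) L(1) by (simp add: ascent_scaleR)
    qed (use assms(3,4) L(2) mutually_commuting_scaleR_left in auto)
    then show ?case by simp
  next
    case (Suc j)
    let ?W = "(L - real j * h) *\<^sub>R T + S"
    have "real j * h \<le> real m * h" using Suc.prems h(1) by (intro mult_right_mono) auto
    then have G: "?W \<in> G_class \<alpha>" using h(3) by (intro path) simp
    have *: "ascent (?W + (- h) *\<^sub>R T) < \<infinity>"
    proof (rule ascent_finite_add[OF Phi[OF G]])
      show "?W \<in> K_class \<alpha>" using G by (simp add: G_class_def)
      show "ascent ?W < \<infinity>" using Suc by simp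
      show "(- h) *\<^sub>R T \<in> commuting_tuples" using assms(2) by (rule commuting_tuples_scaleR)
      show "mutually_commuting ?W ((- h) *\<^sub>R T)"
        using assms(2) mutually_commuting_sym[OF assms(4)]
        by (intro mutually_commuting_add_left mutually_commuting_scaleR_left
            mutually_commuting_scaleR_right) (simp_all add: mutually_commuting_self_iff)
      show "tuple_norm ((- h) *\<^sub>R T) \<le> \<alpha>" unfolding tuple_norm_scaleR using h by simp
    qed
    have "?W + (- h) *\<^sub>R T = (L - real (Suc j) * h) *\<^sub>R T + S"
      by (simp add: algebra_simps)
    with * show ?case by (simp only:)
  qed
  from this[of m] h(3) show ?thesis by simp
qed

end
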